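(* Let $T:\mathbb{N}\to\mathbb{R}_{\ge0}$. The problem of deciding, given a multi-tape Turing machine $M$, whether $M$ runs in time $T(n)$ is undecidable if and only if $T(n)\ge n+1$ for all $n\in\mathbb{N}$.
   Context: $\mathbb{N}=\{0,1,2,\dots\}$. Turing machines are deterministic. A multi-tape Turing machine has a read-only input tape and finitely many work tapes, all both-way infinite; each step is one application of the transition function. A Turing machine $M$ runs in time $T(n)$ if for every $n$, $M$ makes at most $T(n)$ steps on every input of length $n$. A problem is decidable if some algorithm (multi-tape Turing machine) halts on every input and answers it correctly. *)

theory Defs
  imports Complex_Main
begin

section \<open>Multi-tape Turing machines\<close>

datatype move = MoveLeft | Stay | MoveRight

fun offset :: "move \<Rightarrow> int" where
  "offset MoveLeft = -1"
| "offset Stay = 0"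
| "offset MoveRight = 1"

text \<open>
  So that machines can be handed to other machines, states and symbols are named by numbers:
  the states are \<open>{0..<n_states}\<close>, the input alphabet is \<open>{1..n_inputs}\<close>, the tape alphabet is
  \<open>{0..<n_symbols}\<close>, and \<open>0\<close> is the blank. Besides its input tape the machine has \<open>n_work\<close> work
  tapes. In state \<open>q\<close>, reading \<open>a\<close> on the input tape and the symbols \<open>bs\<close> on the work tapes,
  \<open>delta q a bs = (q', m, acts)\<close> gives the new state, the move of the input head, and for every work
  tape the symbol to write and the move of its head.
\<close>

record tm =
  n_states :: nat
  n_inputs :: nat
  n_symbols :: nat
  n_work :: nat
  start :: nat
  acc :: nat
  rej :: nat
  delta :: "nat \<Rightarrow> nat \<Rightarrow> nat list \<Rightarrow> nat \<times> move \<times> (nat \<times> move) list"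

text \<open>
  \<open>delta\<close> is total on the non-halting states (so a machine halts only by entering \<open>acc\<close> or
  \<open>rej\<close>); its values outside the domain described here are never used.
\<close>

definition wf_tm :: "tm \<Rightarrow> bool" where
  "wf_tm M \<longleftrightarrow>
     1 \<le> n_inputs M \<and> n_inputs M < n_symbols M \<and>
     start M < n_states M \<and> acc M < n_states M \<and> rej M < n_states M \<and> acc M \<noteq> rej M \<and>
     (\<forall>q a bs. q < n_states M \<and> q \<notin> {acc M, rej M} \<and> a \<le> n_inputs M \<and>
        length bs = n_work M \<and> set bs \<subseteq> {0..<n_symbols M} \<longrightarrow>
        (case delta M q a bs of (q', m, acts) \<Rightarrow>
           q' < n_states M \<and> length acts = n_work M \<and> fst ` set acts \<subseteq> {0..<n_symbols M}))"

definition inputs :: "tm \<Rightarrow> nat list set" where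
  "inputs M = lists {1..n_inputs M}"

text \<open>The input is written on cells \<open>0, \<dots>, length w - 1\<close> of the input tape.\<close>

definition input_tape :: "nat list \<Rightarrow> int \<Rightarrow> nat" where
  "input_tape w i = (if 0 \<le> i \<and> i < int (length w) then w ! nat i else 0)"

text \<open>
  A configuration consists of the state, the position of the input head, and the contents and head
  position of every work tape. The input is a parameter of the computation, as it never changes.
\<close>

type_synonym config = "nat \<times> int \<times> ((int \<Rightarrow> nat) \<times> int) list"

definition init :: "tm \<Rightarrow> config" where
  "init M = (start M, 0, replicate (n_work M) (\<lambda>_. 0, 0))"

fun act :: "(int \<Rightarrow> nat) \<times> int \<Rightarrow> nat \<times> move \<Rightarrow> (int \<Rightarrow> nat) \<times> int" where
  "act (f, h) (b, m) = (f(h := b), h + offset m)"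

inductive_set step :: "tm \<Rightarrow> nat list \<Rightarrow> (config \<times> config) set"
  for M :: tm and w :: "nat list" where
  "q \<noteq> acc M \<Longrightarrow> q \<noteq> rej M \<Longrightarrow>
   delta M q (input_tape w i) (map (\<lambda>(f, h). f h) ts) = (q', m, acts) \<Longrightarrow>
   ((q, i, ts), (q', i + offset m, map2 act ts acts)) \<in> step M w"

definition runs_in_time :: "tm \<Rightarrow> (nat \<Rightarrow> real) \<Rightarrow> bool" where
  "runs_in_time M T \<longleftrightarrow>
     (\<forall>n. \<forall>w \<in> inputs M. length w = n \<longrightarrow>
        (\<forall>t c. (init M, c) \<in> step M w ^^ t \<longrightarrow> real t \<le> T n))"

definition accepts :: "tm \<Rightarrow> nat list \<Rightarrow> bool" where
  "accepts M w \<longleftrightarrow> (\<exists>i ts. (init M, (acc M, i, ts)) \<in> (step M w)\<^sup>*)"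

definition rejects :: "tm \<Rightarrow> nat list \<Rightarrow> bool" where
  "rejects M w \<longleftrightarrow> (\<exists>i ts. (init M, (rej M, i, ts)) \<in> (step M w)\<^sup>*)"

section \<open>Decidable problems\<close>

text \<open>A problem is a set of words over the binary alphabet, whose letters are named \<open>1\<close> and \<open>2\<close>.\<close>

definition decidable :: "nat list set \<Rightarrow> bool" where
  "decidable A \<longleftrightarrow>
     (\<exists>D. wf_tm D \<and> n_inputs D = 2 \<and>
        (\<forall>w \<in> inputs D. (w \<in> A \<longrightarrow> accepts D w) \<and> (w \<notin> A \<longrightarrow> rejects D w)))"

section \<open>Machines as words\<close>

fun move_code :: "move \<Rightarrow> nat" where
  "move_code MoveLeft = 0"
| "move_code Stay = 1"
| "move_code MoveRight = 2"

fun row_code :: "nat \<times> move \<times> (nat \<times> move) list \<Rightarrow> nat list" where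
  "row_code (q, m, acts) = q # move_code m # concat (map (\<lambda>(b, m). [b, move_code m]) acts)"

text \<open>
  The parameters of the machine, followed by the value table of its transition function. The order
  of the rows, and with it their arguments, is determined by the parameters.
\<close>

definition tm_code :: "tm \<Rightarrow> nat list" where
  "tm_code M =
     [n_states M, n_inputs M, n_symbols M, n_work M, start M, acc M, rej M] @
     concat [row_code (delta M q a bs).
       q \<leftarrow> [0..<n_states M], q \<noteq> acc M \<and> q \<noteq> rej M,
       a \<leftarrow> [0..<Suc (n_inputs M)],
       bs \<leftarrow> List.n_lists (n_work M) [0..<n_symbols M]]"

definition encode :: "tm \<Rightarrow> nat list" where
  "encode M = concat (map (\<lambda>n. replicate n 1 @ [2]) (tm_code M))"

end

theory Submission
  imports Defs "HOL-Library.Nat_Bijection"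
begin

text \<open>
  If \<open>T n0 < n0 + 1\<close>, then a machine running in time \<open>T\<close> halts on inputs of length \<open>n0\<close> before it can
  see their right end. On longer inputs it therefore does the same as on their prefixes of length
  \<open>n0\<close>, and running in time \<open>T\<close> amounts to finitely many bounded simulations, whatever the values of
  \<open>T\<close> are.

  If \<open>T n \<ge> n + 1\<close> for all \<open>n\<close>, suppose that \<open>D\<close> decides the problem. A machine that reads one input
  letter per step and halts at the end of the input runs in time \<open>n + 1\<close>, and meanwhile it can
  perform any computation on its work tapes. Let it compute its own code, run \<open>D\<close> on it, and loop
  forever if \<open>D\<close> accepts: it runs in time \<open>T\<close> if and only if \<open>D\<close> says that it does not.

  Both the decider and the diagonal machine are compiled from primitive recursive functions via
  programs on counter tapes.
\<close>

section \<open>Structured programs on several tapes\<close>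

text \<open>The bound \<open>n + 1\<close> leaves no slack: the blank after \<open>n\<close> letters
  is first seen in step \<open>n + 1\<close>, so every earlier step of the diagonal machine has to
  be paid for by one input letter. Efficiency is irrelevant nevertheless. On inputs too short for
  the hidden computation the machine halts in time anyway, and a single sufficiently long input
  suffices to reach the loop. This is what permits unary counters and numerical codes of whole
  words. Self-reference needs a substitute for the recursion theorem. A chain of \<open>e\<close>
  initial states writes \<open>e\<close> in unary, and the number \<open>e\<close> itself is chosen
  as a code of all other parameters of the machine; these do not depend on \<open>e\<close>, so the
  choice is not circular. For the converse, \<open>T\<close> may be uncomputable and constrains
  infinitely many lengths. The lengths from \<open>n0\<close> on collapse to one condition, given by
  the least integer part of \<open>T n\<close> among them; all bounds then enter the decider as
  constants. A code records only the transitions on legal arguments, so different machines may share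
  a code, and running times must be shown to depend on the code alone.\<close>

type_synonym tape = "(int \<Rightarrow> nat) \<times> int"

abbreviation scan :: "tape \<Rightarrow> nat" where
  "scan \<equiv> \<lambda>(f, h). f h"

datatype com =
    Do "nat list \<Rightarrow> (nat \<times> move) list"
  | Seq com com
  | Cond "nat list \<Rightarrow> bool" com com
  | While "nat list \<Rightarrow> bool" com

text \<open>Only terminating executions are described. This is enough, as the decider run inside the
  program halts on every input and the infinite loop of the diagonal machine is added outside the
  program.\<close>

inductive exec :: "com \<Rightarrow> tape list \<Rightarrow> tape list \<Rightarrow> bool" where
  Do: "ts' = map2 act ts (f (map scan ts)) \<Longrightarrow> exec (Do f) ts ts'"
| Seq: "exec c1 ts ts' \<Longrightarrow> exec c2 ts' ts'' \<Longrightarrow> exec (Seq c1 c2) ts ts''"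
| CondT: "b (map scan ts) \<Longrightarrow> exec c1 ts ts' \<Longrightarrow> exec (Cond b c1 c2) ts ts'"
| CondF: "\<not> b (map scan ts) \<Longrightarrow> exec c2 ts ts' \<Longrightarrow> exec (Cond b c1 c2) ts ts'"
| WhileF: "\<not> b (map scan ts) \<Longrightarrow> exec (While b c) ts ts"
| WhileT: "b (map scan ts) \<Longrightarrow> exec c ts ts' \<Longrightarrow> exec (While b c) ts' ts'' \<Longrightarrow> exec (While b c) ts ts''"

definition stay :: "nat list \<Rightarrow> (nat \<times> move) list" where
  "stay bs = map (\<lambda>b. (b, Stay)) bs"

lemma length_stay [simp]: "length (stay bs) = length bs"
  by (simp add: stay_def)

lemma fst_stay [simp]: "fst ` set (stay bs) = set bs"
  by (force simp: stay_def)

lemma act_stay [simp]: "act t (scan t, Stay) = t"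
  by (cases t) simp

lemma map2_act_stay [simp]: "map2 act ts (stay (map scan ts)) = ts"
  by (induction ts) (auto simp: stay_def)

text \<open>
  The program \<open>c\<close> occupies the program counters \<open>0..<len c\<close>, is entered at \<open>0\<close> and left at
  \<open>len c\<close>.
\<close>

primrec len :: "com \<Rightarrow> nat" where
  "len (Do f) = 1"
| "len (Seq c1 c2) = len c1 + len c2"
| "len (Cond b c1 c2) = Suc (len c1 + len c2)"
| "len (While b c) = Suc (len c)"

text \<open>Each test and each \<open>Do\<close> costs one step, whereas jumps cost none: the exit
  of a branch or of a loop body is redirected to its target at once.\<close>

primrec nxt :: "com \<Rightarrow> nat \<Rightarrow> nat list \<Rightarrow> nat \<times> (nat \<times> move) list" where
  "nxt (Do f) p bs = (1, f bs)"
| "nxt (Seq c1 c2) p bs =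
    (if p < len c1 then nxt c1 p bs
     else apfst ((+) (len c1)) (nxt c2 (p - len c1) bs))"
| "nxt (Cond b c1 c2) p bs =
    (if p = 0 then (if b bs then 1 else Suc (len c1), stay bs)
     else if p \<le> len c1 then
       apfst (\<lambda>q. if q = len c1 then Suc (len c1 + len c2) else Suc q) (nxt c1 (p - 1) bs)
     else apfst ((+) (Suc (len c1))) (nxt c2 (p - Suc (len c1)) bs))"
| "nxt (While b c) p bs =
    (if p = 0 then (if b bs then 1 else Suc (len c), stay bs)
     else apfst (\<lambda>q. if q = len c then 0 else Suc q) (nxt c (p - 1) bs))"

inductive_set run :: "com \<Rightarrow> ((nat \<times> tape list) \<times> (nat \<times> tape list)) set" for c where
  "p < len c \<Longrightarrow> nxt c p (map scan ts) = (p', acts) \<Longrightarrow>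
   ((p, ts), (p', map2 act ts acts)) \<in> run c"

lemma run_iff:
  "((p, ts), (p', ts')) \<in> run c \<longleftrightarrow>
   p < len c \<and> p' = fst (nxt c p (map scan ts)) \<and> ts' = map2 act ts (snd (nxt c p (map scan ts)))"
  by (auto simp: run.simps prod_eq_iff)

lemma single_valued_run: "single_valued (run c)"
  by (auto simp: single_valued_def run_iff)

text \<open>Used to embed the run of a subprogram into a larger one, and later the run of a program
  into that of a machine; \<open>h\<close> renames program counters or adds components.\<close>

lemma rtrancl_lift:
  assumes "(x, y) \<in> R\<^sup>*" and "\<And>x y. (x, y) \<in> R \<Longrightarrow> (h x, h y) \<in> S\<^sup>*"
  shows "(h x, h y) \<in> S\<^sup>*"
  using assms(1) by induction (auto intro: rtrancl_trans assms(2))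

text \<open>With an empty body, the entry \<open>0\<close> would coincide with the exit and be
  redirected.\<close>

lemma len_pos: "0 < len c"
  by (induction c) auto

lemma exec_run: "exec c ts ts' \<Longrightarrow> ((0, ts), (len c, ts')) \<in> (run c)\<^sup>*"
proof (induction rule: exec.induct)
  case (Do ts' ts f)
  then show ?case by (intro r_into_rtrancl) (simp add: run_iff)
next
  case (Seq c1 ts ts' c2 ts'')
  let ?h = "\<lambda>(p, ts). (p + len c1, ts)"
  have "((0, ts), (len c1, ts')) \<in> (run (Seq c1 c2))\<^sup>*"
    by (rule rtrancl_lift[OF Seq.IH(1), of "\<lambda>x. x", simplified])
      (auto simp: run_iff)
  moreover have "(?h (0, ts'), ?h (len c2, ts'')) \<in> (run (Seq c1 c2))\<^sup>*"
    by (rule rtrancl_lift[OF Seq.IH(2)]) (auto simp: run_iff)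
  ultimately show ?case by (simp add: add.commute)
next
  case (CondT b ts c1 ts' c2)
  let ?h = "\<lambda>(p, ts). (if p = len c1 then Suc (len c1 + len c2) else Suc p, ts)"
  have "((0, ts), ?h (0, ts)) \<in> (run (Cond b c1 c2))"
    using CondT.hyps len_pos[of c1] by (auto simp: run_iff)
  moreover have "(?h (0, ts), ?h (len c1, ts')) \<in> (run (Cond b c1 c2))\<^sup>*"
    by (rule rtrancl_lift[OF CondT.IH]) (auto simp: run_iff)
  ultimately show ?case by (simp add: converse_rtrancl_into_rtrancl)
next
  case (CondF b ts c2 ts' c1)
  let ?h = "\<lambda>(p, ts). (Suc (len c1) + p, ts)"
  have "((0, ts), ?h (0, ts)) \<in> (run (Cond b c1 c2))"
    using CondF.hyps by (auto simp: run_iff)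
  moreover have "(?h (0, ts), ?h (len c2, ts')) \<in> (run (Cond b c1 c2))\<^sup>*"
    by (rule rtrancl_lift[OF CondF.IH]) (auto simp: run_iff)
  ultimately show ?case by (simp add: converse_rtrancl_into_rtrancl)
next
  case (WhileF b ts c)
  then show ?case by (intro r_into_rtrancl) (simp add: run_iff)
next
  case (WhileT b ts c ts' ts'')
  let ?h = "\<lambda>(p, ts). (if p = len c then 0 else Suc p, ts)"
  have "((0, ts), ?h (0, ts)) \<in> (run (While b c))"
    using WhileT.hyps len_pos[of c] by (auto simp: run_iff)
  moreover have "(?h (0, ts), ?h (len c, ts')) \<in> (run (While b c))\<^sup>*"
    by (rule rtrancl_lift[OF WhileT.IH(1)]) (auto simp: run_iff)
  ultimately show ?case using WhileT.IH(2) by (auto intro: converse_rtrancl_into_rtrancl rtrancl_trans)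
qed

primrec wf_com :: "nat \<Rightarrow> nat \<Rightarrow> com \<Rightarrow> bool" where
  "wf_com k s (Do f) \<longleftrightarrow> (\<forall>bs. length bs = k \<and> set bs \<subseteq> {0..<s} \<longrightarrow>
     length (f bs) = k \<and> fst ` set (f bs) \<subseteq> {0..<s})"
| "wf_com k s (Seq c1 c2) \<longleftrightarrow> wf_com k s c1 \<and> wf_com k s c2"
| "wf_com k s (Cond b c1 c2) \<longleftrightarrow> wf_com k s c1 \<and> wf_com k s c2"
| "wf_com k s (While b c) \<longleftrightarrow> wf_com k s c"

lemma wf_com_nxt:
  assumes "wf_com k s c" "p < len c" "length bs = k" "set bs \<subseteq> {0..<s}" "nxt c p bs = (p', acts)"
  shows "p' \<le> len c \<and> length acts = k \<and> fst ` set acts \<subseteq> {0..<s}"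
  using assms
proof (induction c arbitrary: p p' acts)
  case (Do f)
  then show ?case by auto
next
  case (Seq c1 c2)
  obtain q1 a1 where 1: "nxt c1 p bs = (q1, a1)" by fastforce
  obtain q2 a2 where 2: "nxt c2 (p - len c1) bs = (q2, a2)" by fastforce
  show ?case
  proof (cases "p < len c1")
    case True
    then show ?thesis using Seq.IH(1)[OF _ True _ _ 1] Seq.prems 1 by auto
  next
    case False
    then show ?thesis using Seq.IH(2)[OF _ _ _ _ 2] Seq.prems 2 by auto
  qed
next
  case (Cond b c1 c2)
  obtain q1 a1 where 1: "nxt c1 (p - 1) bs = (q1, a1)" by fastforce
  obtain q2 a2 where 2: "nxt c2 (p - Suc (len c1)) bs = (q2, a2)" by fastforce
  consider "p = 0" | "p \<noteq> 0" "p \<le> len c1" | "p > len c1" by linarith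
  then show ?case
  proof cases
    case pz: 1
    then show ?thesis using Cond.prems fst_stay[of bs] by (auto split: if_splits simp del: fst_stay)
  next
    case p: 2
    then have "p - 1 < len c1" by linarith
    from Cond.IH(1)[OF _ this _ _ 1] Cond.prems have "q1 \<le> len c1 \<and> length a1 = k \<and> fst ` set a1 \<subseteq> {0..<s}"
      by simp
    then show ?thesis using Cond.prems 1 p by (auto split: if_splits)
  next
    case p: 3
    then show ?thesis using Cond.IH(2)[OF _ _ _ _ 2] Cond.prems 2 by auto
  qed
next
  case (While b c)
  obtain q1 a1 where 1: "nxt c (p - 1) bs = (q1, a1)" by fastforce
  show ?case
    using While.IH[OF _ _ _ _ 1] While.prems 1 fst_stay[of bs]
    by (cases "p = 0") (auto split: if_splits simp del: fst_stay)
qed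

section \<open>Counters\<close>

definition Tp :: "nat \<Rightarrow> (nat \<Rightarrow> nat \<times> move) \<Rightarrow> com" where
  "Tp i g = Do (\<lambda>bs. (stay bs)[i := g (bs ! i)])"

lemma exec_Tp:
  assumes "i < length ts" "ts' = ts[i := act (ts ! i) (g (scan (ts ! i)))]"
  shows "exec (Tp i g) ts ts'"
proof -
  have "map2 act ts ((stay (map scan ts))[i := a]) = ts[i := act (ts ! i) a]" if "i < length ts" for i a
    using that
  proof (induction ts arbitrary: i)
    case (Cons t ts)
    have "stay (map scan (t # ts)) = (scan t, Stay) # stay (map scan ts)" by (simp add: stay_def)
    then show ?case using Cons by (cases i) auto
  qed simp
  from this[OF assms(1), of "g (scan (ts ! i))"] show ?thesis
    unfolding Tp_def using assms by (intro exec.Do) (simp only: nth_map)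
qed

lemma wf_com_Tp [simp]:
  assumes "\<And>b. b < s \<Longrightarrow> fst (g b) < s" "i < k"
  shows "wf_com k s (Tp i g)"
proof -
  have "fst ` set ((stay bs)[i := g (bs ! i)]) \<subseteq> {0..<s}" if "length bs = k" "set bs \<subseteq> {0..<s}" for bs
  proof -
    have "bs ! i \<in> set bs" using that assms(2) by simp
    then have "bs ! i < s" using that(2) by auto
    then have "fst ` insert (g (bs ! i)) (set (stay bs)) \<subseteq> {0..<s}"
      using assms(1) that(2) by (auto simp flip: fst_stay)
    then show ?thesis using set_update_subset_insert[of "stay bs" i "g (bs ! i)"] by blast
  qed
  then show ?thesis by (simp add: Tp_def)
qed

text \<open>
  A counter is a tape whose only non-blank cell is cell \<open>0\<close>; its value is the position of the head.
\<close>

definition ctr :: "nat \<Rightarrow> tape" where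
  "ctr v = ((\<lambda>_. 0)(0 := 1), int v)"

lemma scan_ctr: "scan (ctr v) = (if v = 0 then 1 else 0)"
  by (simp add: ctr_def)

definition st :: "nat \<Rightarrow> (nat \<Rightarrow> nat) \<Rightarrow> tape list \<Rightarrow> tape list" where
  "st m r sp = map (\<lambda>i. ctr (r i)) [0..<m] @ sp"

definition INC :: "nat \<Rightarrow> com" where
  "INC i = Tp i (\<lambda>b. (b, MoveRight))"

definition DEC :: "nat \<Rightarrow> com" where
  "DEC i = Tp i (\<lambda>b. (b, MoveLeft))"

definition nz :: "nat \<Rightarrow> nat list \<Rightarrow> bool" where
  "nz i bs \<longleftrightarrow> bs ! i \<noteq> 1"

lemma nth_st: "i < m \<Longrightarrow> st m r sp ! i = ctr (r i)"
  by (simp add: st_def nth_append)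

lemma length_st [simp]: "length (st m r sp) = m + length sp"
  by (simp add: st_def)

lemma nth_st_special: "st m r sp ! (m + i) = sp ! i"
  by (simp add: st_def nth_append)

lemma st_update: "i < m \<Longrightarrow> (st m r sp)[i := ctr v] = st m (r(i := v)) sp"
  by (auto simp: st_def nth_append nth_list_update intro!: nth_equalityI)

lemma st_update_special: "(st m r sp)[m + i := t] = st m r (sp[i := t])"
  by (simp add: st_def list_update_append)

lemma nz_st: "i < m \<Longrightarrow> nz i (map scan (st m r sp)) \<longleftrightarrow> r i \<noteq> 0"
  using scan_ctr[of "r i"] by (simp add: nz_def nth_st)

text \<open>Uniform in the remaining tapes \<open>sp\<close>, so that counter programs can be
  treated as transformations of the registers alone.\<close>

definition rx :: "nat \<Rightarrow> com \<Rightarrow> (nat \<Rightarrow> nat) \<Rightarrow> (nat \<Rightarrow> nat) \<Rightarrow> bool" where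
  "rx m c r r' \<longleftrightarrow> (\<forall>sp. exec c (st m r sp) (st m r' sp))"

lemma rx_Seq: "rx m c1 r r' \<Longrightarrow> rx m c2 r' r'' \<Longrightarrow> rx m (Seq c1 c2) r r''"
  by (auto simp: rx_def intro: exec.Seq)

lemma rx_CondT: "i < m \<Longrightarrow> r i \<noteq> 0 \<Longrightarrow> rx m c1 r r' \<Longrightarrow> rx m (Cond (nz i) c1 c2) r r'"
  by (auto simp: rx_def nz_st intro: exec.CondT)

lemma rx_CondF: "i < m \<Longrightarrow> r i = 0 \<Longrightarrow> rx m c2 r r' \<Longrightarrow> rx m (Cond (nz i) c1 c2) r r'"
  by (auto simp: rx_def nz_st intro: exec.CondF)

lemma rx_WhileF: "i < m \<Longrightarrow> r i = 0 \<Longrightarrow> rx m (While (nz i) c) r r"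
  by (auto simp: rx_def nz_st intro: exec.WhileF)

lemma rx_WhileT:
  "i < m \<Longrightarrow> r i \<noteq> 0 \<Longrightarrow> rx m c r r' \<Longrightarrow> rx m (While (nz i) c) r' r'' \<Longrightarrow> rx m (While (nz i) c) r r''"
  by (auto simp: rx_def nz_st intro: exec.WhileT)

lemma exec_Tp_st:
  "i < m \<Longrightarrow> ctr v = act (ctr (r i)) (g (scan (ctr (r i)))) \<Longrightarrow> exec (Tp i g) (st m r sp) (st m (r(i := v)) sp)"
  by (intro exec_Tp) (simp_all only: length_st nth_st flip: st_update)

lemma rx_INC: "i < m \<Longrightarrow> r' = r(i := Suc (r i)) \<Longrightarrow> rx m (INC i) r r'"
  unfolding rx_def INC_def by clarify (auto simp: ctr_def fun_eq_iff intro!: exec_Tp_st)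

lemma rx_DEC: "i < m \<Longrightarrow> r i \<noteq> 0 \<Longrightarrow> r' = r(i := r i - 1) \<Longrightarrow> rx m (DEC i) r r'"
  unfolding rx_def DEC_def by clarify (auto simp: ctr_def fun_eq_iff of_nat_diff intro!: exec_Tp_st)

section \<open>Clearing, moving, copying, pairing and unpairing counters\<close>

definition CLR :: "nat \<Rightarrow> com" where
  "CLR i = While (nz i) (DEC i)"

definition MOVE :: "nat \<Rightarrow> nat \<Rightarrow> com" where
  "MOVE i j = While (nz i) (Seq (DEC i) (INC j))"

lemma rx_CLR: "i < m \<Longrightarrow> r' = r(i := 0) \<Longrightarrow> rx m (CLR i) r r'"
proof (induction "r i" arbitrary: r)
  case 0
  then show ?case unfolding CLR_def by (metis fun_upd_idem rx_WhileF)
next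
  case (Suc x)
  show ?case unfolding CLR_def
    by (rule rx_WhileT[OF _ _ rx_DEC[OF _ _ refl] Suc.hyps(1)[unfolded CLR_def]])
      (use Suc.hyps(2)[symmetric] Suc.prems in auto)
qed

lemma rx_MOVE:
  "i < m \<Longrightarrow> j < m \<Longrightarrow> i \<noteq> j \<Longrightarrow> r' = r(i := 0, j := r j + r i) \<Longrightarrow> rx m (MOVE i j) r r'"
proof (induction "r i" arbitrary: r)
  case 0
  then have "r' = r" by (simp add: fun_eq_iff)
  with 0 show ?case unfolding MOVE_def by (simp add: rx_WhileF)
next
  case (Suc x)
  show ?case unfolding MOVE_def
    by (rule rx_WhileT[OF _ _ rx_Seq[OF rx_DEC[OF _ _ refl] rx_INC[OF _ refl]] Suc.hyps(1)[unfolded MOVE_def]])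
      (use Suc.hyps(2)[symmetric] Suc.prems in \<open>auto simp: fun_eq_iff\<close>)
qed

definition DUP :: "nat \<Rightarrow> com" where
  "DUP b = Seq (While (nz b) (Seq (DEC b) (Seq (INC (b + 1)) (INC (b + 2))))) (MOVE (b + 2) b)"

lemma rx_DUP:
  assumes "b + 2 < m" "r (b + 1) = 0" "r (b + 2) = 0" "r' = r(b + 1 := r b)"
  shows "rx m (DUP b) r r'"
proof -
  have "rx m (While (nz b) (Seq (DEC b) (Seq (INC (b + 1)) (INC (b + 2)))))
      r (r(b := 0, b + 1 := r (b + 1) + r b, b + 2 := r (b + 2) + r b))" for r
  proof (induction "r b" arbitrary: r)
    case 0
    then show ?case using assms(1) rx_WhileF[of b m r] by (simp add: fun_upd_idem)
  next
    case (Suc x)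
    let ?r = "r(b := r b - 1, b + 1 := Suc (r (b + 1)), b + 2 := Suc (r (b + 2)))"
    have eq: "r(b := 0, b + 1 := r (b + 1) + r b, b + 2 := r (b + 2) + r b) =
      ?r(b := 0, b + 1 := ?r (b + 1) + ?r b, b + 2 := ?r (b + 2) + ?r b)"
      using Suc.hyps(2) by (auto simp: fun_eq_iff)
    show ?case unfolding eq
      by (rule rx_WhileT[OF _ _ rx_Seq[OF rx_DEC[OF _ _ refl] rx_Seq[OF rx_INC[OF _ refl] rx_INC]] Suc.hyps(1)])
        (use Suc.hyps(2) assms(1) in auto)
  qed
  then show ?thesis unfolding DUP_def
    by (rule rx_Seq[OF _ rx_MOVE]) (use assms in \<open>auto simp: fun_eq_iff\<close>)
qed

text \<open>Within a diagonal the first component grows at the expense of the second; after its end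
  \<open>(a, 0)\<close> the enumeration continues at the start of the next diagonal.\<close>

lemma Suc_prod_encode:
  "Suc (prod_encode (a, Suc b)) = prod_encode (Suc a, b)"
  "Suc (prod_encode (a, 0)) = prod_encode (0, Suc a)"
  by (simp_all add: prod_encode_def)

text \<open>Walks along the diagonals that define \<open>prod_encode\<close>.\<close>

definition UNPAIR :: "nat \<Rightarrow> com" where
  "UNPAIR b = Seq (MOVE b (b + 2)) (While (nz (b + 2)) (Seq (DEC (b + 2))
     (Cond (nz (b + 1)) (Seq (DEC (b + 1)) (INC b)) (Seq (MOVE b (b + 1)) (INC (b + 1))))))"

definition PAIR :: "nat \<Rightarrow> com" where
  "PAIR b = Seq (While (\<lambda>bs. nz b bs \<or> nz (b + 1) bs) (Seq (INC (b + 2))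
     (Cond (nz b) (Seq (DEC b) (INC (b + 1))) (Seq (MOVE (b + 1) b) (DEC b))))) (MOVE (b + 2) b)"

lemma rx_UNPAIR:
  assumes "b + 2 < m" "r (b + 1) = 0" "r (b + 2) = 0" "r b = prod_encode (x, y)" "r' = r(b := x, b + 1 := y)"
  shows "rx m (UNPAIR b) r r'"
proof -
  \<comment> \<open>Invariant of the walk: the number of steps left, in register
    \<open>b + 2\<close>, plus the code of the current pair is the code of the target
    \<open>(x, y)\<close>.\<close>
  have "rx m (While (nz (b + 2)) (Seq (DEC (b + 2))
     (Cond (nz (b + 1)) (Seq (DEC (b + 1)) (INC b)) (Seq (MOVE b (b + 1)) (INC (b + 1))))))
     r (r(b := x, b + 1 := y, b + 2 := 0))"
    if "r (b + 2) + prod_encode (r b, r (b + 1)) = prod_encode (x, y)" for r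
    using that
  proof (induction "r (b + 2)" arbitrary: r)
    case 0
    then have "r b = x" "r (b + 1) = y"
      by (metis add_0 prod.inject prod_encode_eq)+
    with 0 show ?case using assms(1) rx_WhileF[of "b + 2" m r] by (simp add: fun_upd_idem)
  next
    case (Suc k)
    define r1 where "r1 = r(b + 2 := k)"
    define r2 where "r2 = (if r (b + 1) = 0 then r1(b := 0, b + 1 := Suc (r b)) else r1(b := Suc (r b), b + 1 := r (b + 1) - 1))"
    have 1: "rx m (DEC (b + 2)) r r1"
      using Suc.hyps(2)[symmetric] assms(1) by (intro rx_DEC) (auto simp: r1_def)
    have 2: "rx m (Cond (nz (b + 1)) (Seq (DEC (b + 1)) (INC b)) (Seq (MOVE b (b + 1)) (INC (b + 1)))) r1 r2"
    proof (cases "r (b + 1) = 0")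
      case True
      show ?thesis
        by (rule rx_CondF[OF _ _ rx_Seq[OF rx_MOVE[OF _ _ _ refl] rx_INC]])
          (use True assms(1) in \<open>auto simp: r1_def r2_def fun_eq_iff\<close>)
    next
      case False
      show ?thesis
        by (rule rx_CondT[OF _ _ rx_Seq[OF rx_DEC[OF _ _ refl] rx_INC]])
          (use False assms(1) in \<open>auto simp: r1_def r2_def fun_eq_iff\<close>)
    qed
    have k: "r2 (b + 2) = k" by (simp add: r2_def r1_def)
    have "prod_encode (r2 b, r2 (b + 1)) = Suc (prod_encode (r b, r (b + 1)))"
      by (cases "r (b + 1)") (auto simp: r2_def r1_def Suc_prod_encode)
    then have inv: "r2 (b + 2) + prod_encode (r2 b, r2 (b + 1)) = prod_encode (x, y)"
      using Suc.prems Suc.hyps(2) k by simp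
    have "r2(b := x, b + 1 := y, b + 2 := 0) = r(b := x, b + 1 := y, b + 2 := 0)"
      by (auto simp: r2_def r1_def fun_eq_iff)
    then show ?case
      using rx_WhileT[OF _ _ rx_Seq[OF 1 2] Suc.hyps(1)[OF k[symmetric] inv]] assms(1) Suc.hyps(2) by simp
  qed
  note loop = this
  define r1 where "r1 = r(b := 0, b + 2 := r (b + 2) + r b)"
  have 1: "rx m (MOVE b (b + 2)) r r1"
    by (rule rx_MOVE) (use assms(1) in \<open>auto simp: r1_def\<close>)
  have "r1 (b + 2) + prod_encode (r1 b, r1 (b + 1)) = prod_encode (x, y)"
    using assms by (simp add: r1_def prod_encode_def)
  from rx_Seq[OF 1 loop[OF this]]
  have "rx m (UNPAIR b) r (r1(b := x, b + 1 := y, b + 2 := 0))" by (simp add: UNPAIR_def)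
  also have "r1(b := x, b + 1 := y, b + 2 := 0) = r'"
    using assms by (auto simp: r1_def fun_eq_iff)
  finally show ?thesis .
qed

lemma rx_PAIR:
  assumes "b + 2 < m" "r (b + 2) = 0" "r' = r(b := prod_encode (r b, r (b + 1)), b + 1 := 0)"
  shows "rx m (PAIR b) r r'"
proof -
  let ?t = "\<lambda>bs. nz b bs \<or> nz (b + 1) bs"
  let ?c = "Seq (INC (b + 2))
     (Cond (nz b) (Seq (DEC b) (INC (b + 1))) (Seq (MOVE (b + 1) b) (DEC b)))"
  \<comment> \<open>The walk goes backwards to \<open>(0, 0)\<close>, whose code is
    \<open>0\<close>, and register \<open>b + 2\<close> counts its steps.\<close>
  have "rx m (While ?t ?c) r (r(b := 0, b + 1 := 0, b + 2 := r (b + 2) + prod_encode (r b, r (b + 1))))" for r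
  proof (induction "prod_encode (r b, r (b + 1))" arbitrary: r)
    case 0
    then have 00: "r b = 0" "r (b + 1) = 0"
      by (metis add_is_0 le_prod_encode_1 le_prod_encode_2 le_zero_eq)+
    then have "rx m (While ?t ?c) r r"
      using assms(1) by (auto simp: rx_def nz_st intro!: exec.WhileF)
    with 00 0 show ?case by (simp add: fun_upd_idem)
  next
    case (Suc k)
    have nz: "r b \<noteq> 0 \<or> r (b + 1) \<noteq> 0"
    proof (rule ccontr)
      assume "\<not> ?thesis"
      then show False using Suc.hyps(2) by (simp add: prod_encode_def)
    qed
    define r1 where "r1 = r(b + 2 := Suc (r (b + 2)))"
    define r2 where "r2 = (if r b = 0 then r1(b := r (b + 1) - 1, b + 1 := 0) else r1(b := r b - 1, b + 1 := Suc (r (b + 1))))"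
    have 1: "rx m (INC (b + 2)) r r1"
      using assms(1) by (intro rx_INC) (auto simp: r1_def)
    have 2: "rx m (Cond (nz b) (Seq (DEC b) (INC (b + 1))) (Seq (MOVE (b + 1) b) (DEC b))) r1 r2"
    proof (cases "r b = 0")
      case True
      show ?thesis
        by (rule rx_CondF[OF _ _ rx_Seq[OF rx_MOVE[OF _ _ _ refl] rx_DEC]])
          (use True assms(1) nz in \<open>auto simp: r1_def r2_def fun_eq_iff\<close>)
    next
      case False
      show ?thesis
        by (rule rx_CondT[OF _ _ rx_Seq[OF rx_DEC[OF _ _ refl] rx_INC]])
          (use False assms(1) in \<open>auto simp: r1_def r2_def fun_eq_iff\<close>)
    qed
    have S: "Suc (prod_encode (r2 b, r2 (b + 1))) = prod_encode (r b, r (b + 1))"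
      using nz by (cases "r b"; cases "r (b + 1)") (auto simp: r2_def r1_def Suc_prod_encode)
    then have k: "k = prod_encode (r2 b, r2 (b + 1))" using Suc.hyps(2) by simp
    have eq: "r2(b := 0, b + 1 := 0, b + 2 := r2 (b + 2) + prod_encode (r2 b, r2 (b + 1))) =
        r(b := 0, b + 1 := 0, b + 2 := r (b + 2) + prod_encode (r b, r (b + 1)))"
      using S[symmetric] by (auto simp: r2_def r1_def fun_eq_iff)
    have "rx m (While ?t ?c) r2 (r(b := 0, b + 1 := 0, b + 2 := r (b + 2) + prod_encode (r b, r (b + 1))))"
      using Suc.hyps(1)[OF k] unfolding eq .
    moreover have "?t (map scan (st m r sp))" for sp using nz assms(1) by (auto simp: nz_st)
    ultimately show ?case using rx_Seq[OF 1 2] unfolding rx_def by (blast intro: exec.WhileT)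
  qed
  then show ?thesis unfolding PAIR_def
    by (rule rx_Seq[OF _ rx_MOVE]) (use assms in \<open>auto simp: fun_eq_iff\<close>)
qed

section \<open>Primitive recursive functions\<close>

text \<open>Primitive recursion in one argument: pairing replaces arity, and iteration replaces the
  recursion scheme. Total functions suffice, because the decider in the diagonal argument is run as
  a machine and never expressed as a function.\<close>

datatype prec = Zr | Sc | Idt | Lft | Rgt | Cmp prec prec | Pr prec prec | It prec

primrec ev :: "prec \<Rightarrow> nat \<Rightarrow> nat" where
  "ev Zr = (\<lambda>z. 0)"
| "ev Sc = Suc"
| "ev Idt = (\<lambda>z. z)"
| "ev Lft = (\<lambda>z. fst (prod_decode z))"
| "ev Rgt = (\<lambda>z. snd (prod_decode z))"
| "ev (Cmp p q) = (\<lambda>z. ev p (ev q z))"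
| "ev (Pr p q) = (\<lambda>z. prod_encode (ev p z, ev q z))"
| "ev (It p) = (\<lambda>z. (ev p ^^ fst (prod_decode z)) (snd (prod_decode z)))"

text \<open>Register \<open>b\<close> holds the argument and then the result; all registers above it
  are \<open>0\<close> before and after. As there is no empty program, \<open>Idt\<close> moves the
  zero counter \<open>b + 1\<close>.\<close>

primrec cmp :: "prec \<Rightarrow> nat \<Rightarrow> com" where
  "cmp Zr b = CLR b"
| "cmp Sc b = INC b"
| "cmp Idt b = MOVE (b + 1) b"
| "cmp Lft b = Seq (UNPAIR b) (CLR (b + 1))"
| "cmp Rgt b = Seq (UNPAIR b) (Seq (CLR b) (MOVE (b + 1) b))"
| "cmp (Cmp p q) b = Seq (cmp q b) (cmp p b)"
| "cmp (Pr p q) b = Seq (DUP b) (Seq (cmp q (b + 1))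
     (Seq (MOVE b (b + 2)) (Seq (MOVE (b + 1) b) (Seq (MOVE (b + 2) (b + 1))
     (Seq (cmp p (b + 1)) (Seq (MOVE b (b + 2)) (Seq (MOVE (b + 1) b) (Seq (MOVE (b + 2) (b + 1))
     (PAIR b)))))))))"
| "cmp (It p) b = Seq (UNPAIR b) (Seq (While (nz b) (Seq (DEC b) (cmp p (b + 1)))) (MOVE (b + 1) b))"

primrec regs :: "prec \<Rightarrow> nat" where
  "regs Zr = 3"
| "regs Sc = 3"
| "regs Idt = 3"
| "regs Lft = 3"
| "regs Rgt = 3"
| "regs (Cmp p q) = max (regs p) (regs q)"
| "regs (Pr p q) = Suc (max (regs p) (regs q))"
| "regs (It p) = Suc (regs p)"

lemma regs_ge: "3 \<le> regs p"
  by (induction p) auto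

lemma rx_cmp:
  assumes "b + regs p \<le> m" "\<forall>j>b. r j = 0"
  shows "rx m (cmp p b) r (r(b := ev p (r b)))"
  using assms
proof (induction p arbitrary: b r)
  case Zr
  then show ?case by (auto intro!: rx_CLR ext)
next
  case Sc
  then show ?case by (auto intro!: rx_INC ext)
next
  case Idt
  then show ?case by (auto intro!: rx_MOVE)
next
  case Lft
  obtain x y where xy: "prod_decode (r b) = (x, y)" by fastforce
  then have "r b = prod_encode (x, y)" by (metis prod_decode_inverse)
  then show ?case unfolding cmp.simps
    by (intro rx_Seq[OF rx_UNPAIR[OF _ _ _ _ refl] rx_CLR])
      (use Lft xy in \<open>auto simp: fun_eq_iff\<close>)
next
  case Rgt
  obtain x y where xy: "prod_decode (r b) = (x, y)" by fastforce
  then have "r b = prod_encode (x, y)" by (metis prod_decode_inverse)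
  then show ?case unfolding cmp.simps
    by (intro rx_Seq[OF rx_UNPAIR[OF _ _ _ _ refl] rx_Seq[OF rx_CLR[OF _ refl] rx_MOVE]])
      (use Rgt xy in \<open>auto simp: fun_eq_iff\<close>)
next
  case (Cmp p q)
  define r1 where "r1 = r(b := ev q (r b))"
  have "\<forall>j>b. r1 j = 0" using Cmp.prems by (simp add: r1_def)
  then have "rx m (cmp p b) r1 (r1(b := ev p (r1 b)))" using Cmp.prems by (intro Cmp.IH(1)) auto
  moreover have "r1(b := ev p (r1 b)) = r(b := ev p (ev q (r b)))" by (simp add: r1_def)
  moreover have "rx m (cmp q b) r r1" unfolding r1_def using Cmp.prems by (intro Cmp.IH(2)) auto
  ultimately show ?case unfolding cmp.simps ev.simps by (metis rx_Seq)
next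
  case (Pr p q)
  note z = Pr.prems(2)[rule_format]
  note ge = regs_ge[of p] regs_ge[of q]
  define v where "v = r b"
  define s where "s x y = r(b := x, b + 1 := y)" for x y
  have sz: "\<forall>j>b + 1. s x y j = 0" for x y using z by (auto simp: s_def)
  have bm: "b + 3 \<le> m" using Pr.prems(1) ge by simp
  \<comment> \<open>The three moves exchange the two registers through \<open>b + 2\<close>: one
    value waits in \<open>b\<close> while a subprogram works on \<open>b + 1\<close>.\<close>
  have swap: "rx m (Seq (MOVE b (b + 2)) (Seq (MOVE (b + 1) b) (Seq (MOVE (b + 2) (b + 1)) c))) (s x y) r'"
    if "rx m c (s y x) r'" for c x y r'
    by (rule rx_Seq[OF rx_MOVE[OF _ _ _ refl] rx_Seq[OF rx_MOVE[OF _ _ _ refl] rx_Seq[OF rx_MOVE[OF _ _ _ refl]]]])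
      (use bm z that in \<open>auto simp: s_def fun_eq_iff elim!: back_subst[of "\<lambda>x. rx m c x r'"]\<close>)
  have upd: "s x y (b + 1) = y" "(s x y)(b + 1 := z) = s x z" for x y z by (simp_all add: s_def)
  have app: "rx m (cmp p (b + 1)) (s x y) (s x (ev p y))" for x y
    using Pr.IH(1)[OF _ sz] Pr.prems(1) unfolding upd by simp
  have app': "rx m (cmp q (b + 1)) (s x y) (s x (ev q y))" for x y
    using Pr.IH(2)[OF _ sz] Pr.prems(1) unfolding upd by simp
  show ?case unfolding cmp.simps
  proof (rule rx_Seq[OF _ rx_Seq[OF app' swap[OF rx_Seq[OF app swap]]]])
    show "rx m (DUP b) r (s v v)"
      by (rule rx_DUP) (use bm z in \<open>auto simp: s_def v_def fun_eq_iff\<close>)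
    show "rx m (PAIR b) (s (ev p v) (ev q v)) (r(b := ev (Pr p q) (r b)))"
      by (rule rx_PAIR) (use bm z in \<open>auto simp: s_def v_def fun_eq_iff\<close>)
  qed
next
  case (It p)
  note z = It.prems(2)[rule_format]
  note ge = regs_ge[of p]
  have bm: "b + 3 \<le> m" using It.prems(1) ge by simp
  define s where "s x y = r(b := x, b + 1 := y)" for x y
  have sz: "\<forall>j>b + 1. s x y j = 0" for x y using z by (auto simp: s_def)
  have upd: "s x y (b + 1) = y" "(s x y)(b + 1 := z) = s x z" for x y z by (simp_all add: s_def)
  obtain x y where xy: "prod_decode (r b) = (x, y)" by fastforce
  then have "r b = prod_encode (x, y)" by (metis prod_decode_inverse)
  then have 1: "rx m (UNPAIR b) r (s x y)"
    by (intro rx_UNPAIR) (use bm z in \<open>auto simp: s_def\<close>)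
  have 2: "rx m (While (nz b) (Seq (DEC b) (cmp p (b + 1)))) (s x y) (s 0 ((ev p ^^ x) y))" for x y
  proof (induction x arbitrary: y)
    case 0
    have "s 0 y b = 0" by (simp add: s_def)
    then show ?case unfolding funpow_0 using bm by (intro rx_WhileF) auto
  next
    case (Suc x)
    have body: "rx m (cmp p (b + 1)) (s x y) (s x (ev p y))"
      using It.IH[OF _ sz] It.prems(1) unfolding upd by simp
    have dec: "rx m (DEC b) (s (Suc x) y) (s x y)"
      using bm by (intro rx_DEC) (auto simp: s_def)
    have "s (Suc x) y b \<noteq> 0" by (simp add: s_def)
    then show ?case unfolding funpow_Suc_right comp_apply
      using bm by (intro rx_WhileT[OF _ _ rx_Seq[OF dec body] Suc.IH]) auto
  qed
  show ?case unfolding cmp.simps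
    by (rule rx_Seq[OF 1 rx_Seq[OF 2 rx_MOVE]]) (use bm z xy in \<open>auto simp: s_def fun_eq_iff\<close>)
qed

lemma wf_com_INC [simp]: "i < k \<Longrightarrow> wf_com k s (INC i)"
  and wf_com_DEC [simp]: "i < k \<Longrightarrow> wf_com k s (DEC i)"
  by (simp_all add: INC_def DEC_def)

lemma wf_com_cmp: "b + regs p \<le> k \<Longrightarrow> wf_com k s (cmp p b)"
proof (induction p arbitrary: b)
  case (Pr p q)
  then show ?case using regs_ge[of p] regs_ge[of q] by (simp add: DUP_def MOVE_def PAIR_def)
next
  case (It p)
  then show ?case using regs_ge[of p] by (simp add: UNPAIR_def MOVE_def)
qed (simp_all add: CLR_def MOVE_def UNPAIR_def)

section \<open>Computable functions on coded data\<close>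

class coded =
  fixes enc :: "'a \<Rightarrow> nat"
  assumes inj_enc: "inj enc"

lemma enc_eq_iff: "enc x = enc y \<longleftrightarrow> x = y"
  using inj_enc by (auto simp: inj_def)

instantiation nat :: coded
begin
definition "enc_nat (n :: nat) = n"
instance by standard (auto simp: enc_nat_def inj_def)
end

instantiation bool :: coded
begin
definition "enc_bool (b :: bool) = (if b then 1 else 0 :: nat)"
instance by standard (auto simp: enc_bool_def inj_def split: if_splits)
end

instantiation prod :: (coded, coded) coded
begin
definition "enc_prod (p :: 'a \<times> 'b) = prod_encode (enc (fst p), enc (snd p))"
instance by standard (auto simp: enc_prod_def inj_def enc_eq_iff)
end

instantiation list :: (coded) coded
begin
primrec enc_list :: "'a list \<Rightarrow> nat" where
  "enc_list [] = 0"
| "enc_list (x # xs) = Suc (prod_encode (enc x, enc_list xs))"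
instance
proof
  have "enc xs = enc ys \<Longrightarrow> xs = ys" for xs ys :: "'a list"
  proof (induction xs arbitrary: ys)
    case Nil
    then show ?case by (cases ys) auto
  next
    case (Cons x xs)
    then show ?case by (cases ys) (auto simp: enc_eq_iff)
  qed
  then show "inj (enc :: 'a list \<Rightarrow> nat)" by (auto simp: inj_def)
qed
end

text \<open>That is, primitive recursive on codes. The closure rules are stated for composed
  functions, so that \<open>intro\<close> can follow the syntax of a term.\<close>

definition computable :: "('a::coded \<Rightarrow> 'b::coded) \<Rightarrow> bool" where
  "computable f \<longleftrightarrow> (\<exists>p. \<forall>x. ev p (enc x) = enc (f x))"

named_theorems computable_intros

lemma computable_id [computable_intros]: "computable (\<lambda>x. x)"
  unfolding computable_def by (rule exI[of _ Idt]) simp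

lemma computable_const [computable_intros]: "computable (\<lambda>x. c)"
proof -
  have "\<exists>p. \<forall>z. ev p z = n" for n
  proof (induction n)
    case 0
    show ?case by (rule exI[of _ Zr]) simp
  next
    case (Suc n)
    then obtain p where "\<forall>z. ev p z = n" by blast
    then show ?case by (intro exI[of _ "Cmp Sc p"]) simp
  qed
  from this[of "enc c"] show ?thesis unfolding computable_def by auto
qed

lemma computable_compose:
  assumes "computable f" "computable g" shows "computable (\<lambda>x. f (g x))"
proof -
  obtain p q where "\<And>x. ev p (enc x) = enc (f x)" "\<And>x. ev q (enc x) = enc (g x)"
    using assms unfolding computable_def by blast
  then have "\<forall>x. ev (Cmp p q) (enc x) = enc (f (g x))" by simp
  then show ?thesis unfolding computable_def by blast
qed

lemma computable_Pair [computable_intros]: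
  assumes "computable f" "computable g" shows "computable (\<lambda>x. (f x, g x))"
proof -
  obtain p q where "\<And>x. ev p (enc x) = enc (f x)" "\<And>x. ev q (enc x) = enc (g x)"
    using assms unfolding computable_def by blast
  then have "\<forall>x. ev (Pr p q) (enc x) = enc (f x, g x)" by (simp add: enc_prod_def)
  then show ?thesis unfolding computable_def by blast
qed

lemma computable_compose2:
  assumes "computable (\<lambda>p. g (fst p) (snd p))" "computable f" "computable h"
  shows "computable (\<lambda>x. g (f x) (h x))"
  using computable_compose[OF assms(1) computable_Pair[OF assms(2,3)]] by simp

lemma computable_compose3:
  assumes "computable (\<lambda>p. g (fst p) (fst (snd p)) (snd (snd p)))" "computable e" "computable f" "computable h"
  shows "computable (\<lambda>x. g (e x) (f x) (h x))"
  using computable_compose[OF assms(1) computable_Pair[OF assms(2) computable_Pair[OF assms(3,4)]]] by simp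

lemma computable_transfer:
  assumes "computable F" and "\<And>x. F (enc x) = enc (f x)"
  shows "computable f"
proof -
  obtain p where "\<And>x. ev p x = F x"
    using assms(1) unfolding computable_def enc_nat_def by blast
  then have "\<forall>x. ev p (enc x) = enc (f x)" using assms(2) by simp
  then show ?thesis unfolding computable_def by blast
qed

lemma computable_fst [computable_intros]: "computable f \<Longrightarrow> computable (\<lambda>x. fst (f x))"
proof (erule computable_compose[rotated])
  show "computable (fst :: 'b \<times> 'c \<Rightarrow> 'b)"
    unfolding computable_def by (rule exI[of _ Lft]) (simp add: enc_prod_def)
qed

lemma computable_snd [computable_intros]: "computable f \<Longrightarrow> computable (\<lambda>x. snd (f x))"
proof (erule computable_compose[rotated])
  show "computable (snd :: 'b \<times> 'c \<Rightarrow> 'c)"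
    unfolding computable_def by (rule exI[of _ Rgt]) (simp add: enc_prod_def)
qed

lemma computable_prod_decode: "computable f \<Longrightarrow> computable (\<lambda>x. prod_decode (f x))"
proof (erule computable_compose[rotated])
  show "computable prod_decode"
    unfolding computable_def by (rule exI[of _ Idt]) (simp add: enc_prod_def enc_nat_def)
qed

lemma computable_enc: "computable f \<Longrightarrow> computable (\<lambda>x. enc (f x))"
proof (erule computable_compose[rotated])
  show "computable (enc :: 'b \<Rightarrow> nat)"
    unfolding computable_def by (rule exI[of _ Idt]) (simp add: enc_nat_def)
qed

text \<open>\<open>It\<close> iterates a function of one argument, so the parameter \<open>x\<close>
  is carried along unchanged next to the iterated value and projected away at the end.\<close>

lemma computable_funpow [computable_intros]:
  fixes g :: "'a::coded \<Rightarrow> 'b::coded \<Rightarrow> 'b"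
  assumes g: "computable (\<lambda>p. g (fst p) (snd p))" and n: "computable n" and s: "computable s"
  shows "computable (\<lambda>x. (g x ^^ n x) (s x))"
proof -
  have "computable (\<lambda>p. (fst p, g (fst p) (snd p)))"
    by (intro computable_intros g)
  then obtain q where q: "\<And>x y. ev q (prod_encode (enc x, enc y)) = prod_encode (enc x, enc (g x y))"
    unfolding computable_def by (auto simp: enc_prod_def)
  have "computable (\<lambda>x. (n x, x, s x))" by (intro computable_intros n s)
  then obtain a where a: "\<And>x. ev a (enc x) = prod_encode (n x, prod_encode (enc x, enc (s x)))"
    unfolding computable_def by (auto simp: enc_prod_def enc_nat_def)
  have "(ev q ^^ k) (prod_encode (enc x, enc y)) = prod_encode (enc x, enc ((g x ^^ k) y))" for k x y
    by (induction k) (auto simp: q)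
  then have "ev (Cmp Rgt (Cmp (It q) a)) (enc x) = enc ((g x ^^ n x) (s x))" for x
    by (simp add: a)
  then show ?thesis unfolding computable_def by blast
qed

lemma computable_Suc [computable_intros]: "computable f \<Longrightarrow> computable (\<lambda>x. Suc (f x))"
proof (erule computable_compose[rotated])
  show "computable Suc"
    unfolding computable_def by (rule exI[of _ Sc]) (simp add: enc_nat_def)
qed

text \<open>The code of the condition is \<open>0\<close> or \<open>1\<close>. Iterating
  \<open>(a, b) \<mapsto> (a, a)\<close> that many times on the pair of both values leaves the
  chosen one in the second component.\<close>

lemma computable_If [computable_intros]:
  fixes f g :: "'a::coded \<Rightarrow> 'b::coded"
  assumes b: "computable b" and f: "computable f" and g: "computable g"
  shows "computable (\<lambda>x. if b x then f x else g x)"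
proof -
  have "computable (\<lambda>x. snd (((\<lambda>p :: 'b \<times> 'b. (fst p, fst p)) ^^ enc (b x)) (f x, g x)))"
    by (intro computable_intros computable_enc assms)
  also have "(\<lambda>x. snd (((\<lambda>p :: 'b \<times> 'b. (fst p, fst p)) ^^ enc (b x)) (f x, g x))) = (\<lambda>x. if b x then f x else g x)"
    by (auto simp: enc_bool_def)
  finally show ?thesis .
qed

lemma computable_conj [computable_intros]:
  assumes "computable b" "computable c" shows "computable (\<lambda>x. b x \<and> c x)"
proof -
  have "(\<lambda>x. b x \<and> c x) = (\<lambda>x. if b x then c x else False)" by auto
  then show ?thesis by (simp only: computable_If assms computable_const)
qed

lemma computable_not [computable_intros]:
  assumes "computable b" shows "computable (\<lambda>x. \<not> b x)"
proof -
  have "(\<lambda>x. \<not> b x) = (\<lambda>x. if b x then False else True)" by auto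
  then show ?thesis by (simp only: computable_If assms computable_const)
qed

lemma computable_disj [computable_intros]:
  assumes "computable b" "computable c" shows "computable (\<lambda>x. b x \<or> c x)"
proof -
  have "(\<lambda>x. b x \<or> c x) = (\<lambda>x. if b x then True else c x)" by auto
  then show ?thesis by (simp only: computable_If assms computable_const)
qed

section \<open>Arithmetic, comparison and equality\<close>

lemma computable_plus [computable_intros]:
  fixes f g :: "_ \<Rightarrow> nat"
  assumes "computable f" "computable g" shows "computable (\<lambda>x. f x + g x)"
proof -
  have "computable (\<lambda>x. (Suc ^^ f x) (g x))" by (intro computable_intros assms)
  then show ?thesis by simp
qed

lemma computable_times [computable_intros]:
  fixes f g :: "_ \<Rightarrow> nat"
  assumes "computable f" "computable g" shows "computable (\<lambda>x. f x * g x)"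
proof -
  have "computable (\<lambda>x. ((\<lambda>y. g x + y) ^^ f x) 0)"
    by (intro computable_intros computable_compose[OF assms(2)] assms)
  moreover have "((\<lambda>y. a + y) ^^ k) 0 = k * a" for a k :: nat
    by (induction k) auto
  ultimately show ?thesis by simp
qed

lemma computable_pred: "computable f \<Longrightarrow> computable (\<lambda>x. f x - (1 :: nat))"
proof (erule computable_compose[rotated])
  have "computable (\<lambda>n. snd (((\<lambda>p :: nat \<times> nat. (Suc (fst p), fst p)) ^^ n) (0, 0)))" by (intro computable_intros)
  moreover have "((\<lambda>p :: nat \<times> nat. (Suc (fst p), fst p)) ^^ n) (0, 0) = (n, n - 1)" for n
    by (induction n) auto
  ultimately show "computable (\<lambda>n. n - (1 :: nat))" by (simp only: snd_conv)
qed

lemma computable_minus [computable_intros]: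
  fixes f g :: "_ \<Rightarrow> nat"
  assumes "computable f" "computable g" shows "computable (\<lambda>x. f x - g x)"
proof -
  have "computable (\<lambda>x. ((\<lambda>y. y - 1) ^^ g x) (f x))"
    by (intro computable_intros computable_pred assms)
  moreover have "((\<lambda>y. y - 1) ^^ k) a = a - k" for a k :: nat
    by (induction k) auto
  ultimately show ?thesis by simp
qed

lemma computable_eq0: "computable f \<Longrightarrow> computable (\<lambda>x. f x = (0::nat))"
proof (erule computable_compose[rotated])
  have "computable (\<lambda>n. ((\<lambda>_ :: bool. False) ^^ n) True)" by (intro computable_intros)
  moreover have "((\<lambda>_ :: bool. False) ^^ n) True = (n = 0)" for n
    by (cases n) auto
  ultimately show "computable (\<lambda>n. n = (0::nat))" by simp
qed

lemma computable_le [computable_intros]: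
  fixes f g :: "_ \<Rightarrow> nat"
  assumes "computable f" "computable g" shows "computable (\<lambda>x. f x \<le> g x)"
  using computable_eq0[OF computable_minus[OF assms]] by simp

lemma computable_less [computable_intros]:
  fixes f g :: "_ \<Rightarrow> nat"
  assumes "computable f" "computable g" shows "computable (\<lambda>x. f x < g x)"
  using computable_not[OF computable_le[OF assms(2,1)]] by (simp add: not_le)

lemma computable_eq [computable_intros]:
  assumes "computable f" "computable g" shows "computable (\<lambda>x. f x = g x)"
proof -
  have "computable (\<lambda>x. enc (f x) \<le> enc (g x) \<and> enc (g x) \<le> enc (f x))"
    by (intro computable_intros computable_enc assms)
  also have "(\<lambda>x. enc (f x) \<le> enc (g x) \<and> enc (g x) \<le> enc (f x)) = (\<lambda>x. f x = g x)"
    by (auto simp: fun_eq_iff enc_eq_iff simp flip: eq_iff)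
  finally show ?thesis .
qed

section \<open>Lists\<close>

lemma computable_Cons [computable_intros]:
  assumes "computable f" "computable g" shows "computable (\<lambda>x. f x # g x)"
proof -
  have "computable (\<lambda>x. Suc (prod_encode (enc (f x), enc (g x))))"
    using computable_Suc[OF computable_enc[OF computable_Pair[OF assms]]] by (simp add: enc_prod_def)
  then show ?thesis unfolding computable_def by (simp add: enc_nat_def)
qed

text \<open>\<open>hd []\<close> is unspecified but one fixed value, so its code can be built in as
  a constant.\<close>

lemma computable_hd [computable_intros]: "computable f \<Longrightarrow> computable (\<lambda>x. hd (f x))"
proof (erule computable_compose[rotated])
  have "computable (\<lambda>z. if z = 0 then enc (hd [] :: 'b) else fst (prod_decode (z - 1)))"
    by (intro computable_intros computable_prod_decode)
  then show "computable (hd :: 'b list \<Rightarrow> 'b)"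
  proof (rule computable_transfer)
    show "(if enc xs = 0 then enc (hd [] :: 'b) else fst (prod_decode (enc xs - 1))) = enc (hd xs)"
      for xs :: "'b list" by (cases xs) auto
  qed
qed

lemma computable_tl [computable_intros]: "computable f \<Longrightarrow> computable (\<lambda>x. tl (f x))"
proof (erule computable_compose[rotated])
  have "computable (\<lambda>z. if z = 0 then 0 else snd (prod_decode (z - 1)))"
    by (intro computable_intros computable_prod_decode)
  then show "computable (tl :: 'b list \<Rightarrow> 'b list)"
  proof (rule computable_transfer)
    show "(if enc xs = 0 then 0 else snd (prod_decode (enc xs - 1))) = enc (tl xs)"
      for xs :: "'b list" by (cases xs) auto
  qed
qed

text \<open>Provides a computable number of iterations that exhausts the list before its length is
  known to be computable; surplus iterations of a fold are idle.\<close>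

lemma length_le_enc: "length xs \<le> enc xs"
proof (induction xs)
  case (Cons x xs)
  then show ?case using le_prod_encode_2[of "enc xs" "enc x"] by simp
qed simp

lemma computable_foldl [computable_intros]:
  assumes g: "computable (\<lambda>p. g (fst p) (fst (snd p)) (snd (snd p)))"
    and s: "computable s" and xs: "computable xs"
  shows "computable (\<lambda>x. foldl (g x) (s x) (xs x))"
proof -
  let ?step = "\<lambda>x p. if snd p = [] then p else (g x (fst p) (hd (snd p)), tl (snd p))"
  have fold: "fst ((?step x ^^ k) (s, xs)) = foldl (g x) s xs" if "length xs \<le> k" for x k s xs
    using that
  proof (induction k arbitrary: s xs)
    case 0
    then show ?case by simp
  next
    case (Suc k)
    show ?case
    proof (cases xs)
      case Nil
      then show ?thesis using Suc.IH[of "[]" s] by (simp add: funpow_Suc_right del: funpow.simps)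
    next
      case (Cons y ys)
      then show ?thesis using Suc.IH[of ys "g x s y"] Suc.prems
        by (simp add: funpow_Suc_right del: funpow.simps)
    qed
  qed
  have "computable (\<lambda>x. fst ((?step x ^^ enc (xs x)) (s x, xs x)))"
    by (intro computable_intros computable_enc s xs computable_compose3[OF g])
  then show ?thesis by (simp add: fold[OF length_le_enc])
qed

lemma computable_rev [computable_intros]:
  assumes "computable f" shows "computable (\<lambda>x. rev (f x))"
proof -
  have "computable (\<lambda>x. foldl (\<lambda>ys y. y # ys) [] (f x))" by (intro computable_intros assms)
  then show ?thesis by (simp add: rev_conv_fold foldl_conv_fold)
qed

lemma computable_foldr [computable_intros]:
  assumes g: "computable (\<lambda>p. g (fst p) (fst (snd p)) (snd (snd p)))"
    and xs: "computable xs" and s: "computable s"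
  shows "computable (\<lambda>x. foldr (g x) (xs x) (s x))"
proof -
  have "computable (\<lambda>x. foldl (\<lambda>a b. g x b a) (s x) (rev (xs x)))"
    by (intro computable_intros s xs computable_compose3[OF g])
  then show ?thesis by (simp add: foldl_conv_foldr)
qed

lemma computable_append [computable_intros]:
  assumes "computable f" "computable g" shows "computable (\<lambda>x. f x @ g x)"
proof -
  have "computable (\<lambda>x. foldr Cons (f x) (g x))" by (intro computable_intros assms)
  moreover have "foldr Cons xs ys = xs @ ys" for xs ys :: "'b list" by (induction xs) auto
  ultimately show ?thesis by simp
qed

lemma computable_map [computable_intros]:
  assumes g: "computable (\<lambda>p. g (fst p) (snd p))" and f: "computable f"
  shows "computable (\<lambda>x. map (g x) (f x))"
proof -
  have "computable (\<lambda>x. foldr (\<lambda>y ys. g x y # ys) (f x) [])"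
    by (intro computable_intros f computable_compose2[OF g])
  moreover have "foldr (\<lambda>y ys. h y # ys) xs [] = map h xs" for h :: "'b \<Rightarrow> 'c" and xs
    by (induction xs) auto
  ultimately show ?thesis by simp
qed

lemma computable_takeWhile [computable_intros]:
  assumes g: "computable (\<lambda>p. g (fst p) (snd p))" and f: "computable f"
  shows "computable (\<lambda>x. takeWhile (g x) (f x))"
proof -
  have "computable (\<lambda>x. foldr (\<lambda>y ys. if g x y then y # ys else []) (f x) [])"
    by (intro computable_intros f computable_compose2[OF g])
  moreover have "foldr (\<lambda>y ys. if h y then y # ys else []) xs [] = takeWhile h xs" for h :: "'b \<Rightarrow> bool" and xs
    by (induction xs) auto
  ultimately show ?thesis by simp
qed

lemma computable_list_all [computable_intros]:
  assumes g: "computable (\<lambda>p. g (fst p) (snd p))" and f: "computable f"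
  shows "computable (\<lambda>x. list_all (g x) (f x))"
proof -
  have "computable (\<lambda>x. foldr (\<lambda>y b. g x y \<and> b) (f x) True)"
    by (intro computable_intros f computable_compose2[OF g])
  moreover have "foldr (\<lambda>y b. h y \<and> b) xs True = list_all h xs" for h :: "'b \<Rightarrow> bool" and xs
    by (induction xs) auto
  ultimately show ?thesis by simp
qed

lemma computable_concat [computable_intros]:
  assumes "computable f" shows "computable (\<lambda>x. concat (f x))"
proof -
  have "computable (\<lambda>x. foldr append (f x) [])" by (intro computable_intros assms)
  then show ?thesis by (simp add: concat_conv_foldr)
qed

lemma computable_length [computable_intros]:
  assumes "computable f" shows "computable (\<lambda>x. length (f x))"
proof -
  have "computable (\<lambda>x. foldr (\<lambda>_. Suc) (f x) 0)" by (intro computable_intros assms)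
  moreover have "foldr (\<lambda>_. Suc) xs 0 = length xs" for xs :: "'b list" by (induction xs) auto
  ultimately show ?thesis by simp
qed

lemma computable_replicate [computable_intros]:
  assumes "computable n" "computable f" shows "computable (\<lambda>x. replicate (n x) (f x))"
proof -
  have "computable (\<lambda>x. ((\<lambda>ys. f x # ys) ^^ n x) [])"
    by (intro computable_intros computable_compose[OF assms(2)] assms)
  moreover have "((\<lambda>ys. y # ys) ^^ k) [] = replicate k y" for y :: 'b and k by (induction k) auto
  ultimately show ?thesis by simp
qed

lemma computable_drop [computable_intros]:
  assumes "computable n" "computable f" shows "computable (\<lambda>x. drop (n x) (f x))"
proof -
  have "computable (\<lambda>x. (tl ^^ n x) (f x))" by (intro computable_intros assms)
  moreover have "(tl ^^ k) ys = drop k ys" for ys :: "'b list" and k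
    by (induction k) (auto simp: drop_Suc drop_tl)
  ultimately show ?thesis by simp
qed

lemma computable_upt [computable_intros]:
  assumes "computable m" "computable n" shows "computable (\<lambda>x. [m x..<n x])"
proof -
  have "computable (\<lambda>x. ((\<lambda>ys. ys @ [m x + length ys]) ^^ (n x - m x)) [])"
    by (intro computable_intros computable_compose[OF assms(1)] assms)
  moreover have "((\<lambda>ys. ys @ [i + length ys]) ^^ k) [] = [i..<i + k]" for i k by (induction k) auto
  moreover have "[i..<i + (j - i)] = [i..<j]" for i j by (cases "i \<le> j") auto
  ultimately show ?thesis by simp
qed

lemma computable_n_lists [computable_intros]:
  assumes "computable n" "computable f" shows "computable (\<lambda>x. List.n_lists (n x) (f x))"
proof -
  have "computable (\<lambda>x. ((\<lambda>yss. concat (map (\<lambda>ys. map (\<lambda>y. y # ys) (f x)) yss)) ^^ n x) [[]])"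
    by (intro computable_intros computable_compose[OF assms(2)] assms)
  moreover have "((\<lambda>yss. concat (map (\<lambda>ys. map (\<lambda>y. y # ys) xs) yss)) ^^ k) [[]] = List.n_lists k xs"
    for xs :: "'b list" and k by (induction k) auto
  ultimately show ?thesis by simp
qed

section \<open>Reading and writing words\<close>

abbreviation blank :: tape where
  "blank \<equiv> (\<lambda>_. 0, 0)"

definition reg0 :: "nat \<Rightarrow> nat \<Rightarrow> nat" where
  "reg0 z = (\<lambda>_. 0)(0 := z)"

lemma reg0_simps [simp]: "reg0 z 0 = z" "0 < j \<Longrightarrow> reg0 z j = 0" "(reg0 z)(0 := y) = reg0 y"
  by (simp_all add: reg0_def)

lemma exec_Tp_special:
  assumes "i < length sp" "sp' = sp[i := act (sp ! i) (g (scan (sp ! i)))]"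
  shows "exec (Tp (m + i) g) (st m r sp) (st m r sp')"
  using assms by (intro exec_Tp) (simp_all only: length_st nth_st_special st_update_special)

lemma scan_st_special: "i < length sp \<Longrightarrow> map scan (st m r sp) ! (m + i) = scan (sp ! i)"
  by (simp add: st_def nth_append)

lemmas exec_Tp_word = exec_Tp_special[where i = 0, simplified]
lemmas scan_st_word = scan_st_special[where i = 0, simplified]

lemma rx_cmp0:
  assumes "regs p \<le> m"
  shows "exec (cmp p 0) (st m (reg0 z) sp) (st m (reg0 (ev p z)) sp)"
proof -
  have "\<forall>j>0. reg0 z j = 0" by simp
  then show ?thesis using rx_cmp[of 0 p m "reg0 z"] assms unfolding reg0_simps rx_def by simp
qed

definition MARK :: "nat \<Rightarrow> com" where
  "MARK m = Do (\<lambda>bs. map (\<lambda>b. (1, Stay)) (take m bs) @ stay (drop m bs))"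

lemma exec_MARK: "exec (MARK m) (replicate m blank @ sp) (st m (reg0 0) sp)"
proof -
  have "map2 act (replicate m blank) (replicate m (1, Stay)) = map (\<lambda>i. ctr (reg0 0 i)) [0..<m]"
    by (rule nth_equalityI) (auto simp: ctr_def reg0_def)
  then show ?thesis
    unfolding MARK_def by (intro exec.Do) (simp add: st_def map_replicate_const)
qed

lemma wf_com_MARK [simp]: "m \<le> k \<Longrightarrow> 2 \<le> s \<Longrightarrow> wf_com k s (MARK m)"
  by (auto simp: MARK_def image_Un dest: in_set_dropD)

text \<open>Puts the letter \<open>b\<close> in front of a coded word, by the second equation of
  \<open>enc_list\<close>.\<close>

definition pushp :: "nat \<Rightarrow> prec" where
  "pushp b = Cmp Sc (Pr ((Cmp Sc ^^ b) Zr) Idt)"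

lemma ev_pushp [simp]: "ev (pushp b) z = Suc (prod_encode (b, z))"
proof -
  have "ev ((Cmp Sc ^^ b) Zr) z = b" by (induction b) auto
  then show ?thesis by (simp add: pushp_def)
qed

lemma regs_pushp: "regs (pushp b) = 4"
proof -
  have "regs ((Cmp Sc ^^ b) Zr) = 3" by (induction b) auto
  then show ?thesis by (simp add: pushp_def)
qed

text \<open>The word is read from right to left, so that pushing each letter in front rebuilds it in
  the right order. It is erased on the way and the head returns to cell \<open>0\<close>, so the
  tape is blank again and can receive the output.\<close>

definition READ :: "nat \<Rightarrow> com" where
  "READ m = Seq (Tp m (\<lambda>b. (b, MoveLeft))) (Seq
     (While (\<lambda>bs. bs ! m \<noteq> 0)
       (Seq (Cond (\<lambda>bs. bs ! m = 1) (cmp (pushp 1) 0) (cmp (pushp 2) 0)) (Tp m (\<lambda>b. (0, MoveLeft)))))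
     (Tp m (\<lambda>b. (b, MoveRight))))"

lemma input_tape_Nil: "input_tape [] = (\<lambda>_. 0)"
  by (auto simp: input_tape_def)

lemma input_tape_append: "input_tape (u @ [b]) = (input_tape u)(int (length u) := b)"
proof
  fix i
  show "input_tape (u @ [b]) i = ((input_tape u)(int (length u) := b)) i"
  proof (cases "0 \<le> i")
    case True
    then have "nat i < length u \<longleftrightarrow> i < int (length u)" "i = int (length u) \<Longrightarrow> nat i = length u" by auto
    with True show ?thesis by (auto simp: input_tape_def nth_append)
  qed (auto simp: input_tape_def)
qed

lemma input_tape_pop: "(input_tape u)(int (length u) := 0) = input_tape u"
  by (auto simp: input_tape_def)

lemma exec_READ:
  assumes "4 \<le> m" "v \<in> lists {1, 2}"
  shows "exec (READ m) (st m (reg0 0) ((input_tape v, int (length v)) # sp)) (st m (reg0 (enc v)) (blank # sp))"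
proof -
  let ?t = "\<lambda>bs. bs ! m \<noteq> 0"
  let ?c = "Seq (Cond (\<lambda>bs. bs ! m = 1) (cmp (pushp 1) 0) (cmp (pushp 2) 0)) (Tp m (\<lambda>b. (0, MoveLeft)))"
  have "exec (While ?t ?c) (st m (reg0 (enc u)) ((input_tape v, int (length v) - 1) # sp))
      (st m (reg0 (enc (v @ u))) ((\<lambda>_. 0, -1) # sp))" for u
    using assms(2)
  proof (induction v arbitrary: u rule: rev_induct)
    case Nil
    have "\<not> ?t (map scan (st m (reg0 (enc u)) ((input_tape [], - 1) # sp)))"
      by (subst scan_st_word) (simp_all add: input_tape_Nil)
    then show ?case by (auto simp: input_tape_Nil intro: exec.WhileF)
  next
    case (snoc b v)
    let ?s = "st m (reg0 (enc u)) ((input_tape (v @ [b]), int (length v)) # sp)"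
    have b: "b = 1 \<or> b = 2" using snoc.prems by auto
    have scan: "map scan ?s ! m = b"
      by (subst scan_st_word) (simp_all add: input_tape_append)
    have "exec (Cond (\<lambda>bs. bs ! m = 1) (cmp (pushp 1) 0) (cmp (pushp 2) 0)) ?s
        (st m (reg0 (enc (b # u))) ((input_tape (v @ [b]), int (length v)) # sp))"
    proof (cases "b = 1")
      case True
      have "exec (cmp (pushp b) 0) ?s (st m (reg0 (ev (pushp b) (enc u))) ((input_tape (v @ [b]), int (length v)) # sp))"
        using assms(1) by (intro rx_cmp0) (simp add: regs_pushp)
      with True show ?thesis by (intro exec.CondT) (use scan in \<open>auto simp: enc_nat_def\<close>)
    next
      case False
      with b have "b = 2" by simp
      have "exec (cmp (pushp b) 0) ?s (st m (reg0 (ev (pushp b) (enc u))) ((input_tape (v @ [b]), int (length v)) # sp))"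
        using assms(1) by (intro rx_cmp0) (simp add: regs_pushp)
      with \<open>b = 2\<close> show ?thesis by (intro exec.CondF) (use scan in \<open>auto simp: enc_nat_def\<close>)
    qed
    moreover have "exec (Tp m (\<lambda>b. (0, MoveLeft))) (st m (reg0 (enc (b # u))) ((input_tape (v @ [b]), int (length v)) # sp))
        (st m (reg0 (enc (b # u))) ((input_tape v, int (length v) - 1) # sp))"
      by (rule exec_Tp_word) (simp_all add: input_tape_append input_tape_pop)
    ultimately have body: "exec ?c ?s (st m (reg0 (enc (b # u))) ((input_tape v, int (length v) - 1) # sp))"
      by (rule exec.Seq)
    have "exec (While ?t ?c) (st m (reg0 (enc (b # u))) ((input_tape v, int (length v) - 1) # sp))
      (st m (reg0 (enc (v @ b # u))) ((\<lambda>_. 0, -1) # sp))"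
      using snoc.IH[of "b # u"] snoc.prems by simp
    with exec.WhileT[of ?t, OF _ body] scan b show ?case by auto
  qed
  from this[of "[]"] have loop: "exec (While ?t ?c) (st m (reg0 0) ((input_tape v, int (length v) - 1) # sp))
      (st m (reg0 (enc v)) ((\<lambda>_. 0, -1) # sp))" by simp
  show ?thesis unfolding READ_def
    by (rule exec.Seq[OF exec_Tp_word exec.Seq[OF loop exec_Tp_word]]) (simp_all add: fun_upd_idem)
qed

definition calc :: "prec \<Rightarrow> nat \<Rightarrow> com" where
  "calc p m = Seq (MARK m) (Seq (READ m) (cmp p 0))"

lemma exec_calc:
  assumes "4 \<le> m" "regs p \<le> m" "v \<in> lists {1, 2}"
  shows "exec (calc p m) (replicate m blank @ (input_tape v, int (length v)) # sp)
    (st m (reg0 (ev p (enc v))) (blank # sp))"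
  unfolding calc_def using assms
  by (intro exec.Seq[OF exec_MARK exec.Seq[OF exec_READ rx_cmp0]])

lemma wf_com_calc: "4 \<le> m \<Longrightarrow> regs p \<le> m \<Longrightarrow> m < k \<Longrightarrow> 2 \<le> s \<Longrightarrow> wf_com k s (calc p m)"
  by (auto simp: calc_def READ_def regs_pushp intro!: wf_com_cmp wf_com_Tp)

text \<open>The first \<open>DEC\<close> removes the \<open>Suc\<close> in the code of a nonempty
  list, and unpairing leaves the letter in register \<open>0\<close> and the rest in
  \<open>1\<close>. The next \<open>DEC\<close> turns the letters \<open>1\<close>, \<open>2\<close>
  into \<open>0\<close>, \<open>1\<close>, which can be told apart by a zero test.\<close>

definition EMIT :: "nat \<Rightarrow> com" where
  "EMIT m = While (nz 0) (Seq (DEC 0) (Seq (UNPAIR 0) (Seq (DEC 0)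
     (Seq (Cond (nz 0) (Seq (DEC 0) (Tp m (\<lambda>_. (2, MoveRight)))) (Tp m (\<lambda>_. (1, MoveRight))))
     (MOVE 1 0)))))"

lemma exec_EMIT:
  assumes "3 \<le> m" "v \<in> lists {1, 2}"
  shows "exec (EMIT m) (st m (reg0 (enc v)) ((input_tape u, int (length u)) # sp))
    (st m (reg0 0) ((input_tape (u @ v), int (length (u @ v))) # sp))"
  using assms(2)
proof (induction v arbitrary: u rule: list.induct)
  case Nil
  have "\<not> nz 0 (map scan (st m (reg0 0) ((input_tape u, int (length u)) # sp)))"
    using assms(1) by (subst nz_st) auto
  then show ?case unfolding EMIT_def by (auto intro: exec.WhileF)
next
  case (Cons b v)
  define sp1 where "sp1 = (input_tape u, int (length u)) # sp"
  define sp2 where "sp2 = (input_tape (u @ [b]), int (length (u @ [b]))) # sp"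
  define r where "r x = (reg0 x)(1 := enc v)" for x
  have b: "b = 1 \<or> b = 2" using Cons.prems by simp
  have test: "nz 0 (map scan (st m (reg0 (enc (b # v))) sp1))"
    using assms(1) by (subst nz_st) auto
  have "rx m (DEC 0) (reg0 (enc (b # v))) (reg0 (prod_encode (b, enc v)))"
    using assms(1) by (intro rx_DEC) (auto simp: enc_nat_def)
  then have 1: "exec (DEC 0) (st m (reg0 (enc (b # v))) sp1) (st m (reg0 (prod_encode (b, enc v))) sp1)"
    by (simp add: rx_def)
  have "rx m (UNPAIR 0) (reg0 (prod_encode (b, enc v))) (r b)"
    using assms(1) by (intro rx_UNPAIR[where x = b and y = "enc v"]) (auto simp: r_def)
  then have 2: "exec (UNPAIR 0) (st m (reg0 (prod_encode (b, enc v))) sp1) (st m (r b) sp1)"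
    by (simp add: rx_def)
  have dec: "rx m (DEC 0) (r (Suc x)) (r x)" for x
    using assms(1) by (intro rx_DEC) (auto simp: r_def reg0_def)
  then have 3: "exec (DEC 0) (st m (r b) sp1) (st m (r (b - 1)) sp1)"
    using b by (auto simp: rx_def numeral_2_eq_2)
  have push: "exec (Tp m (\<lambda>_. (b, MoveRight))) (st m r' sp1) (st m r' sp2)" for r'
    by (rule exec_Tp_word) (simp_all add: sp1_def sp2_def input_tape_append)
  have 4: "exec (Cond (nz 0) (Seq (DEC 0) (Tp m (\<lambda>_. (2, MoveRight)))) (Tp m (\<lambda>_. (1, MoveRight))))
      (st m (r (b - 1)) sp1) (st m (r 0) sp2)"
  proof (cases "b = 1")
    case True
    have "\<not> nz 0 (map scan (st m (r (b - 1)) sp1))"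
      using assms(1) True by (subst nz_st) (auto simp: r_def)
    with True push show ?thesis by (auto intro: exec.CondF)
  next
    case False
    with b have b2: "b = 2" by simp
    have "nz 0 (map scan (st m (r (b - 1)) sp1))"
      using assms(1) b2 by (subst nz_st) (auto simp: r_def)
    with b2 push dec[of 0] show ?thesis
      by (auto simp: rx_def intro!: exec.CondT intro: exec.Seq)
  qed
  have "rx m (MOVE 1 0) (r 0) (reg0 (enc v))"
    using assms(1) by (intro rx_MOVE) (auto simp: r_def reg0_def)
  then have 5: "exec (MOVE 1 0) (st m (r 0) sp2) (st m (reg0 (enc v)) sp2)"
    by (simp add: rx_def)
  have "exec (EMIT m) (st m (reg0 (enc v)) sp2) (st m (reg0 0) ((input_tape (u @ b # v), int (length (u @ b # v))) # sp))"
    using Cons.IH[of "u @ [b]"] Cons.prems by (simp add: sp2_def)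
  from exec.WhileT[of "nz 0", OF test _ this[unfolded EMIT_def]] 1 2 3 4 5
  show ?case unfolding EMIT_def sp1_def[symmetric] by (blast intro: exec.Seq)
qed

lemma wf_com_EMIT: "3 \<le> m \<Longrightarrow> m < k \<Longrightarrow> 3 \<le> s \<Longrightarrow> wf_com k s (EMIT m)"
  by (auto simp: EMIT_def UNPAIR_def MOVE_def intro!: wf_com_Tp)

definition REWIND :: "nat \<Rightarrow> com" where
  "REWIND m = Seq (Tp m (\<lambda>b. (b, MoveLeft)))
     (Seq (While (\<lambda>bs. bs ! m \<noteq> 0) (Tp m (\<lambda>b. (b, MoveLeft)))) (Tp m (\<lambda>b. (b, MoveRight))))"

lemma exec_REWIND:
  assumes "v \<in> lists {1, 2}"
  shows "exec (REWIND m) (st m r ((input_tape v, int (length v)) # sp)) (st m r ((input_tape v, 0) # sp))"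
proof -
  let ?t = "\<lambda>bs. bs ! m \<noteq> 0"
  have loop: "exec (While ?t (Tp m (\<lambda>b. (b, MoveLeft)))) (st m r ((input_tape v, int n - 1) # sp))
      (st m r ((input_tape v, -1) # sp))" if "n \<le> length v" for n
    using that
  proof (induction n)
    case 0
    have "\<not> ?t (map scan (st m r ((input_tape v, -1) # sp)))"
      by (subst scan_st_word) (simp_all add: input_tape_def)
    then show ?case by (auto intro: exec.WhileF)
  next
    case (Suc n)
    have "v ! n \<in> {1, 2}" using assms Suc.prems by (auto simp: in_lists_conv_set)
    then have "?t (map scan (st m r ((input_tape v, int (Suc n) - 1) # sp)))"
      by (subst scan_st_word) (use Suc.prems in \<open>auto simp: input_tape_def\<close>)
    moreover have "exec (Tp m (\<lambda>b. (b, MoveLeft))) (st m r ((input_tape v, int (Suc n) - 1) # sp))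
        (st m r ((input_tape v, int n - 1) # sp))"
      by (rule exec_Tp_word) simp_all
    ultimately show ?case using Suc.IH Suc.prems by (auto intro: exec.WhileT)
  qed
  show ?thesis unfolding REWIND_def
    by (rule exec.Seq[OF exec_Tp_word exec.Seq[OF loop[OF order_refl] exec_Tp_word]]) simp_all
qed

lemma wf_com_REWIND: "m < k \<Longrightarrow> wf_com k s (REWIND m)"
  by (auto simp: REWIND_def intro!: wf_com_Tp)

section \<open>Running time as bounded halting\<close>

definition stepf :: "tm \<Rightarrow> nat list \<Rightarrow> config \<Rightarrow> config" where
  "stepf M w = (\<lambda>(q, i, ts). case delta M q (input_tape w i) (map scan ts) of
     (q', m, acts) \<Rightarrow> (q', i + offset m, map2 act ts acts))"

definition halted :: "tm \<Rightarrow> config \<Rightarrow> bool" where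
  "halted M c \<longleftrightarrow> fst c = acc M \<or> fst c = rej M"

text \<open>Halted configurations are made fixed points, so that a time bound becomes a statement
  about a single iterate.\<close>

definition nextc :: "tm \<Rightarrow> nat list \<Rightarrow> config \<Rightarrow> config" where
  "nextc M w c = (if halted M c then c else stepf M w c)"

definition halts_within :: "tm \<Rightarrow> nat list \<Rightarrow> nat \<Rightarrow> bool" where
  "halts_within M w b \<longleftrightarrow> halted M ((nextc M w ^^ b) (init M))"

lemma step_iff: "(c, c') \<in> step M w \<longleftrightarrow> \<not> halted M c \<and> c' = nextc M w c"
proof (cases c; cases c')
  fix q i ts q' i' ts' assume "c = (q, i, ts)" "c' = (q', i', ts')"
  then show ?thesis
    by (auto simp: step.simps halted_def nextc_def stepf_def split: prod.split)
qed

lemma relpow_step_nextc: "(c, c') \<in> step M w ^^ t \<Longrightarrow> c' = (nextc M w ^^ t) c"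
  by (induction t arbitrary: c') (auto simp: step_iff)

lemma nextc_relpow_step:
  "\<not> halted M ((nextc M w ^^ t) c) \<Longrightarrow> (c, (nextc M w ^^ Suc t) c) \<in> step M w ^^ Suc t"
proof (induction t)
  case 0
  then show ?case by (simp add: step_iff)
next
  case (Suc t)
  define x where "x = (nextc M w ^^ t) c"
  have nx: "\<not> halted M (nextc M w x)" using Suc.prems by (simp add: x_def)
  then have "\<not> halted M x" by (auto simp: nextc_def)
  then have "(c, nextc M w x) \<in> step M w ^^ Suc t" using Suc.IH by (simp add: x_def)
  moreover have "(nextc M w x, nextc M w (nextc M w x)) \<in> step M w" using nx by (simp add: step_iff)
  ultimately have "(c, nextc M w (nextc M w x)) \<in> step M w ^^ Suc (Suc t)" by (rule relpow_Suc_I)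
  then show ?case by (simp only: x_def funpow.simps(2) o_apply)
qed

lemma nextc_halted: "halted M c \<Longrightarrow> nextc M w c = c"
  by (simp add: nextc_def)

lemma halted_absorbing: "halted M c \<Longrightarrow> (nextc M w ^^ t) c = c"
  by (induction t) (auto simp: nextc_def)

lemma halts_within_mono: "halts_within M w b \<Longrightarrow> b \<le> b' \<Longrightarrow> halts_within M w b'"
proof -
  assume h: "halts_within M w b" and "b \<le> b'"
  then have "(nextc M w ^^ b') (init M) = (nextc M w ^^ (b' - b)) ((nextc M w ^^ b) (init M))"
    using funpow_add[of "b' - b" b "nextc M w"] by simp
  then show ?thesis using h by (simp add: halts_within_def halted_absorbing)
qed

text \<open>If iterate \<open>b\<close> has not halted, it can make step number
  \<open>b + 1\<close>; conversely, by determinism, a run of more than \<open>b\<close> steps leaves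
  iterate \<open>b\<close> by a step, which a halted configuration cannot do.\<close>

lemma halts_within_iff: "halts_within M w b \<longleftrightarrow> (\<forall>t c. (init M, c) \<in> step M w ^^ t \<longrightarrow> t \<le> b)"
proof
  assume h: "halts_within M w b"
  show "\<forall>t c. (init M, c) \<in> step M w ^^ t \<longrightarrow> t \<le> b"
  proof (intro allI impI, rule ccontr)
    fix t c assume c: "(init M, c) \<in> step M w ^^ t" and "\<not> t \<le> b"
    then obtain d where d: "t = Suc b + d" using le_Suc_ex[of "Suc b" t] by auto
    obtain c1 where "(init M, c1) \<in> step M w ^^ Suc b"
      using c unfolding d relpow_add by blast
    then obtain c2 where "(init M, c2) \<in> step M w ^^ b" "(c2, c1) \<in> step M w" by (rule relpow_Suc_E)
    then show False using h relpow_step_nextc[OF \<open>(init M, c2) \<in> step M w ^^ b\<close>]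
      by (simp add: halts_within_def step_iff)
  qed
next
  assume "\<forall>t c. (init M, c) \<in> step M w ^^ t \<longrightarrow> t \<le> b"
  then show "halts_within M w b"
    using nextc_relpow_step[where c = "init M" and t = b and M = M and w = w] unfolding halts_within_def by (meson Suc_n_not_le_n)
qed

lemma runs_in_time_iff:
  assumes "\<And>n. 0 \<le> T n"
  shows "runs_in_time M T \<longleftrightarrow> (\<forall>w \<in> inputs M. halts_within M w (nat \<lfloor>T (length w)\<rfloor>))"
proof -
  have eq: "real t \<le> T n \<longleftrightarrow> t \<le> nat \<lfloor>T n\<rfloor>" for t n
  proof
    assume "t \<le> nat \<lfloor>T n\<rfloor>"
    then have "real t \<le> real (nat \<lfloor>T n\<rfloor>)" by (rule of_nat_mono)
    also have "\<dots> \<le> T n" by (rule of_nat_floor[OF assms])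
    finally show "real t \<le> T n" .
  qed (rule le_nat_floor)
  show ?thesis unfolding runs_in_time_def halts_within_iff eq
    by (intro iffI allI ballI impI; hypsubst?; blast)
qed

section \<open>Machines up to irrelevant transitions\<close>

definition dom_tm :: "tm \<Rightarrow> nat \<Rightarrow> nat \<Rightarrow> nat list \<Rightarrow> bool" where
  "dom_tm M q a bs \<longleftrightarrow> q < n_states M \<and> q \<noteq> acc M \<and> q \<noteq> rej M \<and> a \<le> n_inputs M \<and>
     length bs = n_work M \<and> set bs \<subseteq> {0..<n_symbols M}"

lemma wf_tm_iff: "wf_tm M \<longleftrightarrow> 1 \<le> n_inputs M \<and> n_inputs M < n_symbols M \<and>
     start M < n_states M \<and> acc M < n_states M \<and> rej M < n_states M \<and> acc M \<noteq> rej M \<and>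
     (\<forall>q a bs. dom_tm M q a bs \<longrightarrow> (case delta M q a bs of (q', m, acts) \<Rightarrow>
       q' < n_states M \<and> length acts = n_work M \<and> fst ` set acts \<subseteq> {0..<n_symbols M}))"
  by (simp only: wf_tm_def dom_tm_def insert_iff empty_iff simp_thms de_Morgan_disj conj_assoc)

lemma wf_tmD:
  assumes "wf_tm M" "dom_tm M q a bs" "delta M q a bs = (q', m, acts)"
  shows "q' < n_states M" "length acts = n_work M" "fst ` set acts \<subseteq> {0..<n_symbols M}"
proof -
  have "case delta M q a bs of (q', m, acts) \<Rightarrow>
      q' < n_states M \<and> length acts = n_work M \<and> fst ` set acts \<subseteq> {0..<n_symbols M}"
    using assms(1,2) unfolding wf_tm_iff by simp
  then show "q' < n_states M" "length acts = n_work M" "fst ` set acts \<subseteq> {0..<n_symbols M}"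
    using assms(3) by auto
qed

text \<open>The invariant which ensures that \<open>delta\<close> is only ever consulted on
  \<open>dom_tm\<close>.\<close>

definition ok_config :: "tm \<Rightarrow> config \<Rightarrow> bool" where
  "ok_config M = (\<lambda>(q, i, ts). q < n_states M \<and> length ts = n_work M \<and>
     (\<forall>t \<in> set ts. \<forall>x. fst t x < n_symbols M))"

lemma ok_init: "wf_tm M \<Longrightarrow> ok_config M (init M)"
  by (auto simp: ok_config_def init_def wf_tm_def)

lemma input_tape_le: "w \<in> inputs M \<Longrightarrow> input_tape w i \<le> n_inputs M"
proof -
  assume "w \<in> inputs M"
  then have "w ! j \<le> n_inputs M" if "j < length w" for j
    using that by (auto simp: inputs_def in_lists_conv_set)
  then show ?thesis by (auto simp: input_tape_def)
qed

lemma ok_dom: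
  assumes "ok_config M (q, i, ts)" "w \<in> inputs M" "\<not> halted M (q, i, ts)"
  shows "dom_tm M q (input_tape w i) (map scan ts)"
  using assms input_tape_le[of w M i] by (auto simp: ok_config_def dom_tm_def halted_def)

lemma ok_act:
  assumes "\<forall>t \<in> set ts. \<forall>x. fst t x < s" "fst ` set acts \<subseteq> {0..<s}"
  shows "\<forall>t \<in> set (map2 act ts acts). \<forall>x. fst t x < s"
proof
  fix t assume "t \<in> set (map2 act ts acts)"
  then obtain f h b m where "((f, h), (b, m)) \<in> set (zip ts acts)" and t: "t = act (f, h) (b, m)" by auto
  then have "(f, h) \<in> set ts" "(b, m) \<in> set acts" by (auto dest: set_zip_leftD set_zip_rightD)
  then have "\<forall>x. f x < s" "b < s" using assms by fastforce+
  then show "\<forall>x. fst t x < s" by (simp add: t)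
qed

lemma ok_nextc:
  assumes "wf_tm M" "w \<in> inputs M" "ok_config M c"
  shows "ok_config M (nextc M w c)"
proof (cases c)
  case c: (fields q i ts)
  show ?thesis
  proof (cases "halted M c")
    case False
    obtain q' m acts where d: "delta M q (input_tape w i) (map scan ts) = (q', m, acts)"
      by (metis prod_cases3)
    have "dom_tm M q (input_tape w i) (map scan ts)"
      using ok_dom assms(2,3) False unfolding c by blast
    note wf = wf_tmD[OF assms(1) this d]
    have "\<forall>t \<in> set ts. \<forall>x. fst t x < n_symbols M" using assms(3) c by (simp add: ok_config_def)
    from ok_act[OF this wf(3)] show ?thesis
      using False wf(1,2) assms(3) d unfolding c by (simp add: nextc_def stepf_def ok_config_def)
  qed (use assms(3) in \<open>simp add: nextc_def\<close>)
qed

lemma ok_nextc_funpow: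
  assumes "wf_tm M" "w \<in> inputs M"
  shows "ok_config M ((nextc M w ^^ t) (init M))"
  by (induction t) (auto simp: ok_init ok_nextc assms)

text \<open>Agreement in everything that the code records. Values of \<open>delta\<close> outside
  \<open>dom_tm\<close> are not recorded, so a code determines its machine only up to this
  relation.\<close>

definition same :: "tm \<Rightarrow> tm \<Rightarrow> bool" where
  "same M M' \<longleftrightarrow> n_states M = n_states M' \<and> n_inputs M = n_inputs M' \<and> n_symbols M = n_symbols M' \<and>
     n_work M = n_work M' \<and> start M = start M' \<and> acc M = acc M' \<and> rej M = rej M' \<and>
     (\<forall>q a bs. dom_tm M q a bs \<longrightarrow> delta M q a bs = delta M' q a bs)"

lemma same_sym: "same M M' \<Longrightarrow> same M' M"
  by (auto simp: same_def dom_tm_def)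

lemma same_trans: "same M1 M2 \<Longrightarrow> same M2 M3 \<Longrightarrow> same M1 M3"
  by (auto simp: same_def dom_tm_def)

lemma same_wf:
  assumes "same M M'" "wf_tm M"
  shows "wf_tm M'"
proof -
  have "dom_tm M' q a bs = dom_tm M q a bs" for q a bs
    using assms(1) by (simp add: same_def dom_tm_def)
  with assms show ?thesis unfolding wf_tm_iff by (simp add: same_def)
qed

lemma same_halts_within:
  assumes "same M M'" "wf_tm M" "w \<in> inputs M"
  shows "halts_within M w b \<longleftrightarrow> halts_within M' w b"
proof -
  have halted: "halted M c \<longleftrightarrow> halted M' c" for c
    using assms(1) by (simp add: halted_def same_def)
  have "nextc M w c = nextc M' w c" if "ok_config M c" for c
  proof (cases c)
    case c: (fields q i ts)
    show ?thesis
    proof (cases "halted M c")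
      case False
      then have "delta M q (input_tape w i) (map scan ts) = delta M' q (input_tape w i) (map scan ts)"
        using ok_dom[of M q i ts w] assms(1,3) that unfolding c same_def by simp
      then show ?thesis using False halted unfolding c by (simp add: nextc_def stepf_def)
    qed (simp add: nextc_def halted)
  qed
  note next_eq = this
  have "(nextc M w ^^ b) (init M) = (nextc M' w ^^ b) (init M)"
  proof (induction b)
    case (Suc b)
    then show ?case using next_eq[OF ok_nextc_funpow[OF assms(2,3)], of b] by simp
  qed simp
  moreover have "init M = init M'" using assms(1) by (simp add: init_def same_def)
  ultimately show ?thesis by (simp add: halts_within_def halted)
qed

lemma same_runs_in_time:
  assumes "same M M'" "wf_tm M" "\<And>n. 0 \<le> T n"
  shows "runs_in_time M T \<longleftrightarrow> runs_in_time M' T"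
proof -
  have "inputs M' = inputs M" using assms(1) by (simp add: inputs_def same_def)
  then show ?thesis unfolding runs_in_time_iff[OF assms(3)] using same_halts_within[OF assms(1,2)] by simp
qed

section \<open>Recovering a machine from its code\<close>

definition encL :: "nat list \<Rightarrow> nat list" where
  "encL L = concat (map (\<lambda>n. replicate n 1 @ [2]) L)"

text \<open>Inverts \<open>encL\<close> on its range; on other words the result is arbitrary, and
  this is detected later by encoding it again.\<close>

definition parse :: "nat list \<Rightarrow> nat list" where
  "parse w = foldr (\<lambda>b ns. if b = 2 then 0 # ns else Suc (hd ns) # tl ns) w []"

lemma parse_encL [simp]: "parse (encL L) = L"
proof -
  have "((\<lambda>ns. Suc (hd ns) # tl ns) ^^ n) (k # L) = (k + n) # L" for n k L
    by (induction n) auto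
  then show ?thesis by (induction L) (auto simp: parse_def encL_def)
qed

lemma encode_encL: "encode M = encL (tm_code M)"
  by (simp add: encode_def encL_def)

lemma encL_in_lists: "encL L \<in> lists {1, 2}"
  by (induction L) (auto simp: encL_def)

text \<open>The argument triples in the order of the rows of \<open>tm_code\<close>: the position of
  a triple in this list is the number of its row.\<close>

definition args :: "nat \<Rightarrow> nat \<Rightarrow> nat \<Rightarrow> nat \<Rightarrow> nat \<Rightarrow> nat \<Rightarrow> (nat \<times> nat \<times> nat list) list" where
  "args n qa qr i k s = concat (map (\<lambda>q. if q \<noteq> qa \<and> q \<noteq> qr then
     concat (map (\<lambda>a. map (\<lambda>bs. (q, a, bs)) (List.n_lists k [0..<s])) [0..<Suc i]) else []) [0..<n])"

definition header :: "tm \<Rightarrow> nat list" where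
  "header M = [n_states M, n_inputs M, n_symbols M, n_work M, start M, acc M, rej M]"

definition args_tm :: "tm \<Rightarrow> (nat \<times> nat \<times> nat list) list" where
  "args_tm M = args (n_states M) (acc M) (rej M) (n_inputs M) (n_work M) (n_symbols M)"

lemma set_args_tm: "(q, a, bs) \<in> set (args_tm M) \<longleftrightarrow> dom_tm M q a bs"
  by (force simp: args_tm_def args_def dom_tm_def set_n_lists less_Suc_eq_le)

lemma tm_code_args:
  "tm_code M = header M @ concat (map (\<lambda>(q, a, bs). row_code (delta M q a bs)) (args_tm M))"
  unfolding tm_code_def header_def args_tm_def args_def
  by (simp add: map_concat comp_def if_distrib cong: if_cong)

definition move_of :: "nat \<Rightarrow> move" where
  "move_of n = (if n = 0 then MoveLeft else if n = 1 then Stay else MoveRight)"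

lemma move_of_code [simp]: "move_of (move_code m) = m"
  by (cases m) (auto simp: move_of_def)

lemma move_code_of [simp]: "move_code (move_of n) = min 2 n"
  by (auto simp: move_of_def)

lemma min_move_code [simp]: "min 2 (move_code m) = move_code m"
  by (cases m) auto

text \<open>
  Unlike \<open>L ! j\<close>, whose value for \<open>j \<ge> length L\<close> is an unspecified function of \<open>j\<close>, this is
  computable.
\<close>

definition entry :: "nat list \<Rightarrow> nat \<Rightarrow> nat" where
  "entry L j = hd (drop j L)"

lemma entry_nth: "j < length L \<Longrightarrow> entry L j = L ! j"
  by (simp add: entry_def hd_drop_conv_nth)

definition argsL :: "nat list \<Rightarrow> (nat \<times> nat \<times> nat list) list" where
  "argsL L = args (entry L 0) (entry L 5) (entry L 6) (entry L 1) (entry L 3) (entry L 2)"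

text \<open>Skips the \<open>7\<close> header entries and all earlier rows. A row has
  \<open>2 + 2 * k\<close> entries for \<open>k\<close> work tapes: the new state, the move of the
  input head, and a symbol and a move per tape. The length of the \<open>takeWhile\<close> is the
  row number of \<open>x\<close>.\<close>

definition rowL :: "nat list \<Rightarrow> nat \<times> nat \<times> nat list \<Rightarrow> nat \<Rightarrow> nat" where
  "rowL L x i = entry L (7 + (length (takeWhile (\<lambda>y. y \<noteq> x) (argsL L)) * (2 + 2 * entry L 3) + i))"

text \<open>Moves are kept as numbers, so that all data are of coded types; the cap at
  \<open>2\<close> makes each of them the code of the move that \<open>move_of\<close> assigns to
  it.\<close>

definition deltaL :: "nat list \<Rightarrow> nat \<times> nat \<times> nat list \<Rightarrow> nat \<times> nat \<times> (nat \<times> nat) list" where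
  "deltaL L x = (rowL L x 0, min 2 (rowL L x 1),
     map (\<lambda>j. (rowL L x (2 + j * 2), min 2 (rowL L x (3 + j * 2)))) [0..<entry L 3])"

definition tmL :: "nat list \<Rightarrow> tm" where
  "tmL L = \<lparr>n_states = entry L 0, n_inputs = entry L 1, n_symbols = entry L 2, n_work = entry L 3,
     start = entry L 4, acc = entry L 5, rej = entry L 6,
     delta = \<lambda>q a bs. case deltaL L (q, a, bs) of (q', m, acts) \<Rightarrow>
       (q', move_of m, map (\<lambda>(b, m). (b, move_of m)) acts)\<rparr>"

lemma nth_concat_uniform:
  assumes "\<forall>xs \<in> set xss. length xs = r" "j < length xss" "i < r"
  shows "concat xss ! (j * r + i) = xss ! j ! i" "j * r + i < length (concat xss)"
proof -
  have "concat xss ! (j * r + i) = xss ! j ! i \<and> j * r + i < length (concat xss)"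
    using assms
  proof (induction xss arbitrary: j)
    case (Cons xs xss)
    then show ?case by (cases j) (auto simp: nth_append)
  qed simp
  then show "concat xss ! (j * r + i) = xss ! j ! i" "j * r + i < length (concat xss)" by auto
qed

lemma same_tmL:
  assumes "wf_tm M"
  shows "same M (tmL (tm_code M))"
proof -
  define L where "L = tm_code M"
  define k where "k = n_work M"
  let ?rows = "map (\<lambda>(q, a, bs). row_code (delta M q a bs)) (args_tm M)"
  have L: "L = header M @ concat ?rows" by (simp add: L_def tm_code_args)
  have hd: "entry L 0 = n_states M" "entry L 1 = n_inputs M" "entry L 2 = n_symbols M"
    "entry L 3 = k" "entry L 4 = start M" "entry L 5 = acc M" "entry L 6 = rej M"
    by (simp_all add: L header_def entry_def k_def)
  have len7: "length (header M) = 7" by (simp add: header_def)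
  have argsL: "argsL L = args_tm M" unfolding argsL_def args_tm_def hd k_def by (rule refl)
  have len: "\<forall>r \<in> set ?rows. length r = 2 + 2 * k"
  proof
    fix r assume "r \<in> set ?rows"
    then obtain q a bs where q: "dom_tm M q a bs" and r: "r = row_code (delta M q a bs)"
      by (auto simp: set_args_tm)
    obtain q' m acts where d: "delta M q a bs = (q', m, acts)" by (metis prod_cases3)
    have "length (concat (map (\<lambda>(b, m). [b, move_code m]) acts)) = 2 * length acts"
      by (induction acts) auto
    then show "length r = 2 + 2 * k" using wf_tmD[OF assms q d] d by (simp add: r k_def)
  qed
  have "delta M q a bs = delta (tmL L) q a bs" if dom: "dom_tm M q a bs" for q a bs
  proof -
    define x where "x = (q, a, bs)"
    define j where "j = length (takeWhile (\<lambda>y. y \<noteq> x) (argsL L))"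
    have x: "x \<in> set (args_tm M)" by (simp add: x_def set_args_tm dom)
    then have j: "j < length (args_tm M)"
      unfolding j_def argsL
      by (metis (mono_tags, lifting) not_less take_all takeWhile_eq_all_conv takeWhile_eq_take)
    then have xj: "args_tm M ! j = x"
      using nth_length_takeWhile[of "\<lambda>y. y \<noteq> x" "args_tm M"] by (simp add: j_def argsL)
    obtain q' m acts where d: "delta M q a bs = (q', m, acts)" by (metis prod_cases3)
    note wf = wf_tmD[OF assms dom d]
    have jr: "?rows ! j = row_code (q', m, acts)" using j xj d by (simp add: x_def)
    have row: "rowL L x i = row_code (q', m, acts) ! i" if "i < 2 + 2 * k" for i
    proof -
      have "rowL L x i = entry L (length (header M) + (j * (2 + 2 * k) + i))"
        by (simp only: rowL_def j_def hd len7)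
      also have "\<dots> = entry (concat ?rows) (j * (2 + 2 * k) + i)"
        by (simp add: entry_def L)
      also have "\<dots> = row_code (q', m, acts) ! i"
        using nth_concat_uniform[OF len, of j i] j that unfolding jr
        by (simp only: length_map entry_nth)
      finally show ?thesis .
    qed
    have pairs: "\<forall>xs \<in> set (map (\<lambda>(b, m). [b, move_code m]) acts). length xs = 2" by auto
    have act: "rowL L x (2 + i * 2) = fst (acts ! i)" "rowL L x (3 + i * 2) = move_code (snd (acts ! i))"
      if "i < k" for i
    proof -
      have "rowL L x (2 + (i * 2 + 0)) = fst (acts ! i)"
        using that wf nth_concat_uniform(1)[OF pairs, of i 0] unfolding k_def
        by (subst row) (auto simp: k_def split_def)
      moreover have "rowL L x (2 + (i * 2 + 1)) = move_code (snd (acts ! i))"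
        using that wf nth_concat_uniform(1)[OF pairs, of i 1] unfolding k_def
        by (subst row) (auto simp: k_def split_def)
      ultimately show "rowL L x (2 + i * 2) = fst (acts ! i)" "rowL L x (3 + i * 2) = move_code (snd (acts ! i))"
        by (simp_all add: numeral_3_eq_3 numeral_2_eq_2)
    qed
    have "map (\<lambda>j. (rowL L x (2 + j * 2), min 2 (rowL L x (3 + j * 2)))) [0..<k] =
      map (\<lambda>(b, m). (b, move_code m)) acts"
      using wf(2) by (intro nth_equalityI) (simp_all add: act split_def k_def[symmetric] del: add_2_eq_Suc add_2_eq_Suc')
    moreover have "rowL L x 0 = q'" "rowL L x 1 = move_code m" using row[of 0] row[of 1] by auto
    ultimately have "deltaL L x = (q', move_code m, map (\<lambda>(b, m). (b, move_code m)) acts)"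
      unfolding deltaL_def hd by simp
    then show ?thesis by (simp add: tmL_def d x_def split_def comp_def)
  qed
  then show ?thesis by (simp add: same_def tmL_def hd hd[unfolded One_nat_def] k_def flip: L_def)
qed

text \<open>That \<open>encode M\<close> belongs to the problem is witnessed by some machine with
  this code, perhaps not by \<open>M\<close>. Both are \<open>same\<close> as the machine recovered
  from the code.\<close>

lemma tm_code_inj:
  assumes "wf_tm M" "wf_tm M'" "encode M = encode M'"
  shows "same M M'"
proof -
  have "tm_code M = tm_code M'" using assms(3) parse_encL unfolding encode_encL by metis
  then show ?thesis using same_tmL[OF assms(1)] same_tmL[OF assms(2)] same_sym same_trans by metis
qed

lemma same_tm_code: "same M M' \<Longrightarrow> tm_code M = tm_code M'"
proof -
  assume s: "same M M'"
  then have "args_tm M' = args_tm M" "header M' = header M" by (simp_all add: args_tm_def header_def same_def)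
  moreover have "row_code (delta M q a bs) = row_code (delta M' q a bs)" if "(q, a, bs) \<in> set (args_tm M)" for q a bs
    using s that by (simp add: same_def set_args_tm)
  ultimately show ?thesis unfolding tm_code_args by (auto intro!: arg_cong[of _ _ concat] map_cong)
qed

section \<open>Running a machine as a subprogram\<close>

text \<open>Tape \<open>m\<close> serves as the input tape of \<open>D\<close> and its letter is
  written back unchanged; the work tapes of \<open>D\<close> follow, and one cell of the last tape
  stores the state of \<open>D\<close> as a symbol. The fallback to \<open>stay\<close> keeps the
  action legal on arguments outside the domain of \<open>D\<close>.\<close>

definition run_step :: "tm \<Rightarrow> nat \<Rightarrow> nat \<Rightarrow> nat list \<Rightarrow> (nat \<times> move) list" where
  "run_step D m s bs =
     (case delta D (bs ! (m + Suc (n_work D))) (bs ! m) (take (n_work D) (drop (Suc m) bs)) of (q, mv, acts) \<Rightarrow>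
        if length acts = n_work D \<and> fst ` set acts \<subseteq> {0..<s} \<and> q < s
        then stay (take m bs) @ (bs ! m, mv) # acts @ [(q, Stay)] else stay bs)"

definition RUN :: "tm \<Rightarrow> nat \<Rightarrow> nat \<Rightarrow> com" where
  "RUN D m s = Seq (Tp (m + Suc (n_work D)) (\<lambda>_. (start D, Stay)))
     (While (\<lambda>bs. bs ! (m + Suc (n_work D)) \<noteq> acc D \<and> bs ! (m + Suc (n_work D)) \<noteq> rej D) (Do (run_step D m s)))"

definition emb :: "nat \<Rightarrow> nat list \<Rightarrow> config \<Rightarrow> tape list" where
  "emb m w = (\<lambda>(q, i, ts). st m (reg0 0) ((input_tape w, i) # ts @ [((\<lambda>_. 0)(0 := q), 0)]))"

lemma scan_emb_state:
  assumes "ok_config D c"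
  shows "map scan (emb m w c) ! (m + Suc (n_work D)) = fst c"
proof (cases c)
  case (fields q i ts)
  then show ?thesis using assms unfolding emb_def
    by (simp only: split_conv, subst scan_st_special) (auto simp: ok_config_def nth_append)
qed

lemma exec_run_step:
  assumes "wf_tm D" "w \<in> inputs D" "ok_config D c" "\<not> halted D c" "n_symbols D \<le> s" "n_states D \<le> s"
  shows "exec (Do (run_step D m s)) (emb m w c) (emb m w (nextc D w c))"
proof (cases c)
  case c: (fields q i ts)
  define A where "A = map (\<lambda>i. ctr (reg0 0 i)) [0..<m]"
  define a where "a = input_tape w i"
  define bs where "bs = map scan A @ a # map scan ts @ [q]"
  have len: "length ts = n_work D" using assms(3) by (simp add: c ok_config_def)
  have lenA: "length A = m" by (simp add: A_def)
  have emb: "emb m w (q', i', ts') = A @ (input_tape w, i') # ts' @ [((\<lambda>_. 0)(0 := q'), 0)]" for q' i' ts'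
    by (simp add: emb_def st_def A_def)
  have scan: "map scan (emb m w c) = bs" by (simp add: c emb bs_def a_def)
  have bs: "bs ! m = a" "take m bs = map scan A" "take (n_work D) (drop (Suc m) bs) = map scan ts"
    using len lenA by (simp_all add: bs_def nth_append)
  have bsq: "bs ! (m + Suc (n_work D)) = q"
    using scan_emb_state[OF assms(3), of m w] unfolding scan by (simp add: c)
  obtain q' mv acts where d: "delta D q a (map scan ts) = (q', mv, acts)" by (metis prod_cases3)
  have "dom_tm D q a (map scan ts)" using ok_dom[of D q i ts w] assms(2-4) by (simp add: c a_def)
  note wf = wf_tmD[OF assms(1) this d]
  have "length acts = n_work D \<and> fst ` set acts \<subseteq> {0..<s} \<and> q' < s"
    using wf assms(5,6) by force
  then have "run_step D m s bs = stay (map scan A) @ (a, mv) # acts @ [(q', Stay)]"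
    unfolding run_step_def bs bsq d by simp
  moreover have "nextc D w c = (q', i + offset mv, map2 act ts acts)"
    using assms(4) d by (simp add: nextc_def c stepf_def a_def)
  moreover have "map2 act (emb m w c) (stay (map scan A) @ (a, mv) # acts @ [(q', Stay)]) =
      emb m w (q', i + offset mv, map2 act ts acts)"
    using lenA len wf(2) unfolding c emb by (simp add: a_def)
  ultimately show ?thesis by (intro exec.Do) (simp add: scan)
qed

lemma exec_RUN:
  assumes "wf_tm D" "w \<in> inputs D" "(init D, c) \<in> (step D w)\<^sup>*" "halted D c" "n_symbols D \<le> s" "n_states D \<le> s"
  shows "exec (RUN D m s) (st m (reg0 0) ((input_tape w, 0) # replicate (n_work D) blank @ [blank])) (emb m w c)"
proof -
  let ?t = "\<lambda>bs. bs ! (m + Suc (n_work D)) \<noteq> acc D \<and> bs ! (m + Suc (n_work D)) \<noteq> rej D"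
  have test: "?t (map scan (emb m w c)) \<longleftrightarrow> \<not> halted D c" if "ok_config D c" for c
    unfolding scan_emb_state[OF that] by (auto simp: halted_def)
  have "ok_config D c0 \<longrightarrow> exec (While ?t (Do (run_step D m s))) (emb m w c0) (emb m w c)"
    if "(c0, c) \<in> (step D w)\<^sup>*" for c0
    using that
  proof (induction rule: converse_rtrancl_induct)
    case base
    show ?case
    proof
      assume ok: "ok_config D c"
      show "exec (While ?t (Do (run_step D m s))) (emb m w c) (emb m w c)"
        by (rule exec.WhileF) (use test[OF ok] assms(4) in blast)
    qed
  next
    case (step c0 c1)
    then have nh: "\<not> halted D c0" and c1: "c1 = nextc D w c0" by (auto simp: step_iff)
    show ?case
    proof
      assume ok: "ok_config D c0"
      then have "ok_config D c1" unfolding c1 by (rule ok_nextc[OF assms(1,2)])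
      with step.IH have rest: "exec (While ?t (Do (run_step D m s))) (emb m w c1) (emb m w c)" by (rule mp)
      have "?t (map scan (emb m w c0))" unfolding test[OF ok] by (rule nh)
      then show "exec (While ?t (Do (run_step D m s))) (emb m w c0) (emb m w c)"
        using exec_run_step[OF assms(1,2) ok nh assms(5,6)] rest unfolding c1 by (rule exec.WhileT)
    qed
  qed
  from this[OF assms(3)] have loop: "exec (While ?t (Do (run_step D m s))) (emb m w (init D)) (emb m w c)"
    using ok_init[OF assms(1)] by blast
  have "exec (Tp (m + Suc (n_work D)) (\<lambda>_. (start D, Stay)))
      (st m (reg0 0) ((input_tape w, 0) # replicate (n_work D) blank @ [blank])) (emb m w (init D))"
    unfolding emb_def init_def split_conv
    by (rule exec_Tp_special) (simp_all add: nth_append list_update_append)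
  then show ?thesis unfolding RUN_def using loop by (rule exec.Seq)
qed

lemma wf_com_RUN:
  assumes "start D < s"
  shows "wf_com (m + n_work D + 2) s (RUN D m s)"
proof -
  have "length (run_step D m s bs) = m + n_work D + 2 \<and> fst ` set (run_step D m s bs) \<subseteq> {0..<s}"
    if bs: "length bs = m + n_work D + 2" "set bs \<subseteq> {0..<s}" for bs
  proof -
    obtain q mv acts where d: "delta D (bs ! (m + Suc (n_work D))) (bs ! m) (take (n_work D) (drop (Suc m) bs)) = (q, mv, acts)"
      by (metis prod_cases3)
    have stay: "fst ` set (stay bs) \<subseteq> {0..<s}" "fst ` set (stay (take m bs)) \<subseteq> {0..<s}"
      unfolding fst_stay using bs(2) set_take_subset[of m bs] by (simp, blast)
    have "bs ! m \<in> set bs" using bs(1) by simp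
    then have "bs ! m < s" using bs(2) by auto
    then show ?thesis using bs(1) stay unfolding run_step_def d
      by (simp add: image_Un del: fst_stay)
  qed
  then show ?thesis unfolding RUN_def wf_com.simps using assms by (intro conjI wf_com_Tp) simp_all
qed

section \<open>Clocked machines\<close>

text \<open>
  A clocked machine advances on its input tape in every step and halts at the right end of the
  input. It starts in a chain of \<open>e\<close> states that perform the actions \<open>ch\<close>, continues with the
  program \<open>F\<close>, and does not obey the clock any more once \<open>F\<close> has terminated with the symbol \<open>qa\<close> on
  tape \<open>j\<close>.
\<close>

definition clocked_delta :: "com \<Rightarrow> nat \<Rightarrow> nat \<Rightarrow> nat \<Rightarrow> (nat \<times> move) list \<Rightarrow>
    nat \<Rightarrow> nat \<Rightarrow> nat list \<Rightarrow> nat \<times> move \<times> (nat \<times> move) list" where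
  "clocked_delta F k j qa ch q a bs =
     (if q = len F then (if bs ! j = qa then len F else len F + 1, Stay, stay bs)
      else if q < len F then
        (if a = 0 then (len F + 1, Stay, stay bs)
         else case nxt F q bs of (q', acts) \<Rightarrow> (q', MoveRight, acts))
      else if a = 0 then (len F + 1, Stay, replicate k (0, Stay))
      else (if q = len F + 3 then 0 else q - 1, MoveRight, ch))"

text \<open>The states below \<open>len F\<close> are program counters, \<open>len F\<close> is the
  exit test, two halting states follow, and the chain lies above them and is counted down. Chain
  states are placed last so that no other transition depends on \<open>e\<close>. The input is a
  mere clock, hence the unary alphabet.\<close>

definition clocked :: "com \<Rightarrow> nat \<Rightarrow> nat \<Rightarrow> nat \<Rightarrow> nat \<Rightarrow> (nat \<times> move) list \<Rightarrow> nat \<Rightarrow> tm" where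
  "clocked F k s j qa ch e = \<lparr>n_states = len F + 3 + e, n_inputs = 1, n_symbols = s, n_work = k,
     start = len F + 3 + e - 1, acc = len F + 1, rej = len F + 2, delta = clocked_delta F k j qa ch\<rparr>"

lemma clocked_simps [simp]:
  "n_states (clocked F k s j qa ch e) = len F + 3 + e"
  "n_inputs (clocked F k s j qa ch e) = 1"
  "n_symbols (clocked F k s j qa ch e) = s"
  "n_work (clocked F k s j qa ch e) = k"
  "start (clocked F k s j qa ch e) = len F + 3 + e - 1"
  "acc (clocked F k s j qa ch e) = len F + 1"
  "rej (clocked F k s j qa ch e) = len F + 2"
  "delta (clocked F k s j qa ch e) = clocked_delta F k j qa ch"
  by (simp_all add: clocked_def)

lemma wf_clocked:
  assumes "wf_com k s F" "2 \<le> s" "length ch = k" "fst ` set ch \<subseteq> {0..<s}" "0 < e"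
  shows "wf_tm (clocked F k s j qa ch e)"
proof -
  have "case clocked_delta F k j qa ch q a bs of (q', m, acts) \<Rightarrow>
      q' < len F + 3 + e \<and> length acts = k \<and> fst ` set acts \<subseteq> {0..<s}"
    if "dom_tm (clocked F k s j qa ch e) q a bs" for q a bs
  proof -
    have bs: "length bs = k" "set bs \<subseteq> {0..<s}" and q: "q < len F + 3 + e"
      using that by (auto simp: dom_tm_def)
    obtain q' acts where n: "nxt F q bs = (q', acts)" by fastforce
    have "fst ` set (stay bs) \<subseteq> {0..<s}" "fst ` set (replicate k (0, Stay)) \<subseteq> {0..<s}"
      using bs assms(2) by auto
    moreover have "q' < len F + 3 + e \<and> length acts = k \<and> fst ` set acts \<subseteq> {0..<s}" if "q < len F"
      using wf_com_nxt[OF assms(1) that bs n] by simp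
    moreover have "q - 1 < len F + 3 + e" using q by simp
    ultimately show ?thesis using bs(1) q assms(3-5) n
      by (simp add: clocked_delta_def del: fst_stay)
  qed
  then show ?thesis using assms(2,5) unfolding wf_tm_iff clocked_simps by simp
qed

context
  fixes F :: com and k s j qa e :: nat and ch :: "(nat \<times> move) list"
    and t0 :: "nat \<Rightarrow> tape list" and tsf :: "tape list" and M :: tm
  assumes chain_start: "t0 0 = replicate k blank"
    and chain_step: "\<And>i. map2 act (t0 i) ch = t0 (Suc i)"
    and final: "((0, t0 e), (len F, tsf)) \<in> (run F)\<^sup>*"
    and e: "0 < e"
  defines "M \<equiv> clocked F k s j qa ch e"
begin

text \<open>The state after \<open>i\<close> steps of the chain, from the start state down to
  \<open>len F + 3\<close>; after \<open>e\<close> steps it is the entry of the program.\<close>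

definition chain_state :: "nat \<Rightarrow> nat" where
  "chain_state i = (if i < e then len F + 2 + (e - i) else 0)"

lemma clocked_init: "init M = (chain_state 0, 0, t0 0)"
  using e by (simp add: init_def M_def chain_state_def chain_start)

lemma clocked_halted: "halted M c \<longleftrightarrow> fst c = len F + 1 \<or> fst c = len F + 2"
  by (simp add: halted_def M_def)

lemma chain_state_gt: "i < e \<Longrightarrow> len F + 2 < chain_state i"
  by (simp add: chain_state_def)

lemma clocked_chain:
  assumes "i < e" "input_tape w (int i) \<noteq> 0"
  shows "nextc M w (chain_state i, int i, t0 i) = (chain_state (Suc i), int (Suc i), t0 (Suc i))"
proof -
  have "\<not> halted M (chain_state i, int i, t0 i)" using chain_state_gt[OF assms(1)] by (simp add: clocked_halted)
  moreover have "clocked_delta F k j qa ch (chain_state i) (input_tape w (int i)) bs = (chain_state (Suc i), MoveRight, ch)" for bs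
    using assms by (auto simp: clocked_delta_def chain_state_def)
  ultimately show ?thesis by (simp add: nextc_def stepf_def M_def chain_step)
qed

lemma clocked_run:
  assumes "((p, ts), (p', ts')) \<in> run F" "input_tape w i \<noteq> 0"
  shows "nextc M w (p, i, ts) = (p', i + 1, ts')"
proof -
  have "\<not> halted M (p, i, ts)" using assms(1) by (simp add: clocked_halted run_iff)
  with assms show ?thesis
    by (auto simp: nextc_def stepf_def M_def clocked_delta_def run_iff split: prod.split)
qed

lemma clocked_end:
  assumes "chain_state i = q \<and> i < e \<or> q < len F" "input_tape w h = 0"
  shows "halted M (nextc M w (q, h, ts))"
proof -
  have "\<not> halted M (q, h, ts)" using assms(1) by (auto simp: clocked_halted chain_state_def)
  with assms show ?thesis
    by (auto simp: nextc_def stepf_def M_def clocked_delta_def chain_state_def halted_def)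
qed

lemma clocked_exit:
  shows "map scan tsf ! j = qa \<Longrightarrow> nextc M w (len F, h, tsf) = (len F, h, tsf)"
    and "map scan tsf ! j \<noteq> qa \<Longrightarrow> halted M (nextc M w (len F, h, tsf))"
  by (simp_all add: nextc_def stepf_def M_def clocked_delta_def halted_def)

text \<open>By determinism a reachable configuration lies either before or after the final one, and
  the final one has no successor.\<close>

lemma run_F_cases:
  assumes "((0, t0 e), (q, ts)) \<in> (run F)\<^sup>*"
  obtains "q = len F" "ts = tsf" | q' ts' where "q < len F" "((q, ts), (q', ts')) \<in> run F"
proof -
  have "((q, ts), (len F, tsf)) \<in> (run F)\<^sup>* \<or> ((len F, tsf), (q, ts)) \<in> (run F)\<^sup>*"
    using single_valued_confluent[OF single_valued_run assms final] by blast
  then show ?thesis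
  proof
    assume "((q, ts), (len F, tsf)) \<in> (run F)\<^sup>*"
    then show ?thesis
    proof (cases rule: converse_rtranclE)
      case base
      then show ?thesis using that(1) by simp
    next
      case (step y)
      then show ?thesis using that(2)[of "fst y" "snd y"] by (cases y) (simp add: run_iff)
    qed
  next
    assume "((len F, tsf), (q, ts)) \<in> (run F)\<^sup>*"
    then show ?thesis
    proof (cases rule: converse_rtranclE)
      case base
      then show ?thesis using that(1) by simp
    next
      case (step y)
      then show ?thesis by (cases y) (simp add: run_iff)
    qed
  qed
qed

text \<open>While the machine has not halted, its head after \<open>t\<close> steps is on cell
  \<open>t\<close>, inside the input or on the blank behind it. On that blank the next step halts,
  and so does the exit test, should the program finish before.\<close>

lemma clocked_halts:
  assumes "map scan tsf ! j \<noteq> qa" "w \<in> inputs M"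
  shows "halts_within M w (length w + 1)"
proof -
  have sym: "input_tape w (int t) \<noteq> 0" if "t < length w" for t
  proof -
    have "w ! t \<in> {1..n_inputs M}" using assms(2) nth_mem[OF that] unfolding inputs_def in_lists_conv_set by blast
    with that show ?thesis by (simp add: input_tape_def)
  qed
  have sym0: "input_tape w (int (length w)) = 0" by (simp add: input_tape_def)
  have "halted M ((nextc M w ^^ t) (init M)) \<or>
      (\<exists>q ts. (nextc M w ^^ t) (init M) = (q, int t, ts) \<and> t \<le> length w \<and>
        (t < e \<and> q = chain_state t \<and> ts = t0 t \<or> ((0, t0 e), (q, ts)) \<in> (run F)\<^sup>*))" for t
  proof (induction t)
    case 0
    show ?case using e by (simp add: clocked_init)
  next
    case (Suc t)
    let ?c = "(nextc M w ^^ t) (init M)"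
    show ?case
    proof (cases "halted M ?c")
      case True
      then have "nextc M w ?c = ?c" by (rule nextc_halted)
      with True show ?thesis by simp
    next
      case False
      then obtain q ts where c: "?c = (q, int t, ts)" and t: "t \<le> length w"
        and or: "t < e \<and> q = chain_state t \<and> ts = t0 t \<or> ((0, t0 e), (q, ts)) \<in> (run F)\<^sup>*"
        using Suc.IH by blast
      from or show ?thesis
      proof
        assume ch: "t < e \<and> q = chain_state t \<and> ts = t0 t"
        show ?thesis
        proof (cases "t = length w")
          case True
          then show ?thesis using clocked_end[of t q w "int t" ts] ch c sym0 by simp
        next
          case False
          with t have tl: "t < length w" by simp
          have nx: "nextc M w ?c = (chain_state (Suc t), int (Suc t), t0 (Suc t))"
            using clocked_chain[OF _ sym[OF tl]] ch c by simp
          show ?thesis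
          proof (cases "Suc t < e")
            case True
            then show ?thesis using nx tl by simp
          next
            case False
            then have "Suc t = e" using ch by simp
            then have "chain_state (Suc t) = 0" "t0 (Suc t) = t0 e" by (simp_all add: chain_state_def)
            then show ?thesis using nx tl by simp
          qed
        qed
      next
        assume r: "((0, t0 e), (q, ts)) \<in> (run F)\<^sup>*"
        then show ?thesis
        proof (cases rule: run_F_cases)
          case 1
          then show ?thesis using clocked_exit(2)[OF assms(1)] c by simp
        next
          case (2 q' ts')
          show ?thesis
          proof (cases "t = length w")
            case True
            then show ?thesis using clocked_end[of t q w "int t" ts] 2 c sym0 by simp
          next
            case False
            with t have tl: "t < length w" by simp
            have "nextc M w ?c = (q', int (Suc t), ts')" using clocked_run[OF 2(2) sym[OF tl]] c by simp
            moreover have "((0, t0 e), (q', ts')) \<in> (run F)\<^sup>*" using r 2(2) by (rule rtrancl_into_rtrancl)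
            ultimately show ?thesis using tl by simp
          qed
        qed
      qed
    qed
  qed
  \<comment> \<open>At this time the second alternative would require
    \<open>length w + 1 \<le> length w\<close>.\<close>
  from this[of "length w + 1"] show ?thesis unfolding halts_within_def by auto
qed

text \<open>On an input that outlasts the chain and the program, the machine reaches the exit test,
  which then repeats itself forever.\<close>

lemma clocked_loops:
  assumes "map scan tsf ! j = qa"
  shows "\<exists>w \<in> inputs M. \<forall>b. \<not> halts_within M w b"
proof -
  obtain l where l: "((0, t0 e), (len F, tsf)) \<in> run F ^^ l"
    using final rtrancl_power by blast
  \<comment> \<open>One letter for each of the \<open>e\<close> steps of the chain and the
    \<open>l\<close> steps of \<open>F\<close>.\<close>
  define w where "w = replicate (e + l) (1::nat)"
  have w: "w \<in> inputs M" by (auto simp: w_def inputs_def M_def in_lists_conv_set)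
  have sym: "input_tape w (int t) \<noteq> 0" if "t < e + l" for t
    using that by (simp add: input_tape_def w_def)
  have chain: "(nextc M w ^^ t) (init M) = (chain_state t, int t, t0 t)" if "t \<le> e" for t
    using that by (induction t) (simp_all add: clocked_init clocked_chain sym)
  have "(nextc M w ^^ d) (0, int e, t0 e) = (p, int (e + d), ts)"
    if "((0, t0 e), (p, ts)) \<in> run F ^^ d" "d \<le> l" for d p ts
    using that
  proof (induction d arbitrary: p ts)
    case (Suc d)
    then obtain p' ts' where 1: "((0, t0 e), (p', ts')) \<in> run F ^^ d" "((p', ts'), (p, ts)) \<in> run F" by auto
    have "nextc M w (p', int (e + d), ts') = (p, int (e + d) + 1, ts)"
      using clocked_run[OF 1(2)] sym[of "e + d"] Suc.prems by simp
    then show ?case using Suc.IH[OF 1(1)] Suc.prems by simp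
  qed simp
  from this[OF l] have "(nextc M w ^^ l) ((nextc M w ^^ e) (init M)) = (len F, int (e + l), tsf)"
    using chain[of e] by (simp add: chain_state_def)
  then have el: "(nextc M w ^^ (l + e)) (init M) = (len F, int (e + l), tsf)" by (simp add: funpow_add)
  have "(nextc M w ^^ d) (len F, h, tsf) = (len F, h, tsf)" for d h
    by (induction d) (simp_all add: clocked_exit(1)[OF assms])
  moreover have "(nextc M w ^^ (b + (l + e))) (init M) = (nextc M w ^^ b) ((nextc M w ^^ (l + e)) (init M))" for b
    by (simp only: funpow_add o_apply)
  ultimately have "(nextc M w ^^ (b + (l + e))) (init M) = (len F, int (e + l), tsf)" for b
    by (simp only: el)
  then have "\<not> halts_within M w (b + (l + e))" for b
    by (simp add: halts_within_def clocked_halted)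
  then have "\<not> halts_within M w b" for b
    using halts_within_mono[of M w b "b + (l + e)"] by auto
  with w show ?thesis by blast
qed

lemma clocked_runs_in_time:
  assumes "\<And>n. real n + 1 \<le> T n"
  shows "runs_in_time M T \<longleftrightarrow> map scan tsf ! j \<noteq> qa"
proof -
  have "0 \<le> T n" for n using assms[of n] by (rule order_trans[rotated]) simp
  note iff = runs_in_time_iff[OF this, of M]
  have "n + 1 \<le> nat \<lfloor>T n\<rfloor>" for n using assms[of n] by (intro le_nat_floor) simp
  then show ?thesis unfolding iff
    using clocked_halts clocked_loops halts_within_mono by blast
qed

end

section \<open>Undecidability\<close>

text \<open>The code of a clocked machine as a function of \<open>e\<close>, with all else as
  parameters: \<open>K\<close> states outside the chain, the rest \<open>h1\<close>,
  \<open>h2\<close> of the header, the rows \<open>X\<close> of the program. A chain state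
  contributes the block \<open>bA\<close> for the blank and \<open>B\<close> equal rows for the
  letter; they are equal because the actions of the chain ignore the scanned work symbols.\<close>

definition word_of :: "nat \<Rightarrow> nat \<Rightarrow> nat list \<Rightarrow> nat list \<Rightarrow> nat list \<Rightarrow> nat list \<Rightarrow> nat list \<Rightarrow> nat \<Rightarrow> nat list" where
  "word_of e K h1 h2 X bA tail B = encL ((K + e) # h1 @ (K + e - 1) # h2 @ X @
     concat (map (\<lambda>i. bA @ concat (replicate B ((if i = 0 then 0 else K + i - 1) # tail))) [0..<e]))"

lemma computable_encL [computable_intros]:
  assumes "computable f" shows "computable (\<lambda>x. encL (f x))"
  unfolding encL_def by (intro computable_intros assms)

lemma computable_word_of:
  "computable (\<lambda>p. word_of (fst p) (fst (snd p)) (fst (snd (snd p))) (fst (snd (snd (snd p))))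
     (fst (snd (snd (snd (snd p))))) (fst (snd (snd (snd (snd (snd p))))))
     (fst (snd (snd (snd (snd (snd (snd p))))))) (snd (snd (snd (snd (snd (snd (snd p))))))))"
  unfolding word_of_def by (intro computable_intros)

text \<open>No program row mentions \<open>e\<close>. It enters only through two header entries and
  the number of chain blocks.\<close>

lemma encode_clocked:
  defines "B k s \<equiv> length (List.n_lists k [0..<s])"
  shows "encode (clocked F k s j qa ch e) = word_of e (len F + 3) [1, s, k] [len F + 1, len F + 2]
    (concat (map (\<lambda>(q, a, bs). row_code (clocked_delta F k j qa ch q a bs))
       (args (len F + 3) (len F + 1) (len F + 2) 1 k s)))
    (concat (replicate (B k s) (row_code (len F + 1, Stay, replicate k (0, Stay)))))
    (tl (row_code (0, MoveRight, ch))) (B k s)"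
proof -
  let ?row = "\<lambda>(q, a, bs). row_code (clocked_delta F k j qa ch q a bs)"
  let ?args = "\<lambda>q. concat (map (\<lambda>a. map (\<lambda>bs. (q, a, bs)) (List.n_lists k [0..<s])) [0..<Suc 1])"
  let ?blk = "\<lambda>i. concat (replicate (B k s) (row_code (len F + 1, Stay, replicate k (0, Stay)))) @
      concat (replicate (B k s) ((if i = 0 then 0 else len F + 3 + i - 1) # tl (row_code (0, MoveRight, ch))))"
  have cc: "concat (concat xss) = concat (map concat xss)" for xss :: "nat list list list"
    by (induction xss) auto
  have "concat (map ?row (?args (len F + 3 + i))) = ?blk i" for i
    by (simp add: clocked_delta_def comp_def map_replicate_const B_def)
  moreover have "[0..<len F + 3 + e] = [0..<len F + 3] @ map (\<lambda>i. len F + 3 + i) [0..<e]"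
    using upt_add_eq_append[of 0 "len F + 3" e] map_add_upt[of "len F + 3" e] by (simp add: add.commute del: upt_Suc)
  then have "args (len F + 3 + e) (len F + 1) (len F + 2) 1 k s =
      args (len F + 3) (len F + 1) (len F + 2) 1 k s @ concat (map (\<lambda>i. ?args (len F + 3 + i)) [0..<e])"
    by (simp add: args_def comp_def del: upt_Suc)
  ultimately have "concat (map ?row (args (len F + 3 + e) (len F + 1) (len F + 2) 1 k s)) =
      concat (map ?row (args (len F + 3) (len F + 1) (len F + 2) 1 k s)) @ concat (map ?blk [0..<e])"
    by (simp add: map_concat comp_def cc del: upt_Suc)
  then show ?thesis
    by (simp only: encode_encL tm_code_args header_def args_tm_def clocked_simps word_of_def append.simps)
qed

theorem undecidable_if_ge_Suc:
  assumes T: "\<And>n. real n + 1 \<le> T n"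
  shows "\<not> decidable {encode M | M. wf_tm M \<and> runs_in_time M T}"
proof
  assume "decidable {encode M | M. wf_tm M \<and> runs_in_time M T}"
  then obtain D where D: "wf_tm D" "n_inputs D = 2"
    and dec: "\<And>w. w \<in> inputs D \<Longrightarrow> w \<in> {encode M | M. wf_tm M \<and> runs_in_time M T} \<Longrightarrow> accepts D w"
      "\<And>w. w \<in> inputs D \<Longrightarrow> w \<notin> {encode M | M. wf_tm M \<and> runs_in_time M T} \<Longrightarrow> rejects D w"
    unfolding decidable_def by blast
  obtain p1 where p1: "\<And>e K h1 h2 X bA tail B. ev p1 (enc (e, K, h1, h2, X, bA, tail, B)) =
      enc (word_of e K h1 h2 X bA tail B)"
    using computable_word_of unfolding computable_def by fastforce
  \<comment> \<open>The length \<open>e\<close> found on the tape is used twice, as the number of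
    chain states and as the code of the other parameters: with \<open>e = enc tup\<close>, pairing
    it with itself gives \<open>enc (e, tup)\<close>.\<close>
  have "computable (\<lambda>v :: nat list. (length v, length v))" by (intro computable_intros)
  then obtain p2 where p2: "\<And>v :: nat list. ev p2 (enc v) = prod_encode (length v, length v)"
    unfolding computable_def by (auto simp: enc_prod_def enc_nat_def)
  define p where "p = Cmp p1 p2"
  define m where "m = regs p + 1"
  have m: "4 \<le> m" "regs p \<le> m" using regs_ge[of p] by (simp_all add: m_def)
  \<comment> \<open>Words need the symbols \<open>0\<close>, \<open>1\<close>, \<open>2\<close>; the
    simulation also uses the symbols of \<open>D\<close> and, for the state tape, its
    states.\<close>
  define s where "s = max 3 (max (n_symbols D) (n_states D))"
  have s: "n_symbols D \<le> s" "n_states D \<le> s" "3 \<le> s" by (simp_all add: s_def)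
  define k where "k = m + n_work D + 2"
  define F where "F = Seq (calc p m) (Seq (EMIT m) (Seq (REWIND m) (RUN D m s)))"
  have "start D < s" using D(1) s by (simp add: wf_tm_def)
  then have wfF: "wf_com k s F"
    using m s wf_com_RUN[of D s m]
    by (simp add: F_def k_def wf_com_calc wf_com_EMIT wf_com_REWIND)
  \<comment> \<open>Each step of the chain appends a \<open>1\<close> to the word on tape
    \<open>m\<close> and leaves the other tapes blank.\<close>
  define ch where "ch = replicate m (0 :: nat, Stay) @ (1, MoveRight) # replicate (n_work D + 1) (0, Stay)"
  have ch: "length ch = k" "fst ` set ch \<subseteq> {0..<s}" using s by (auto simp: ch_def k_def)
  define j where "j = m + Suc (n_work D)"
  define B where "B = length (List.n_lists k [0..<s])"
  define tup where "tup = (len F + 3, [1, s, k], [len F + 1, len F + 2],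
    concat (map (\<lambda>(q, a, bs). row_code (clocked_delta F k j (acc D) ch q a bs))
       (args (len F + 3) (len F + 1) (len F + 2) 1 k s)),
    concat (replicate B (row_code (len F + 1, Stay, replicate k (0, Stay)))),
    tl (row_code (0, MoveRight, ch)), B)"
  txt \<open>
    \<open>e\<close> codes everything in the description of the machine except \<open>e\<close> itself, so \<open>F\<close>, which finds
    \<open>e\<close> in unary on its word tape, can compute the code of the machine that it is part of.
  \<close>
  define e where "e = enc tup"
  \<comment> \<open>With an empty chain the start state would be the rejecting state.\<close>
  have e: "0 < e"
  proof -
    have "fst tup = len F + 3" by (simp add: tup_def)
    then have "e = prod_encode (len F + 3, enc (snd tup))" by (simp only: e_def enc_prod_def enc_nat_def)
    then show ?thesis using le_prod_encode_1[of "len F + 3" "enc (snd tup)"] by simp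
  qed
  define M where "M = clocked F k s j (acc D) ch e"
  define w where "w = encode M"
  have wfM: "wf_tm M" unfolding M_def using s by (intro wf_clocked wfF ch e) simp
  have "w \<in> lists {1, 2}" unfolding w_def encode_encL by (rule encL_in_lists)
  moreover have "{1, 2} = {1..2::nat}" by auto
  ultimately have w12: "w \<in> lists {1, 2}" and wD: "w \<in> inputs D" by (simp_all add: inputs_def D(2))
  define t0 where "t0 i = replicate m blank @ (input_tape (replicate i 1), int i) # replicate (n_work D + 1) blank" for i
  have evp: "ev p (enc (replicate e (1::nat))) = enc w"
  proof -
    have "ev p (enc (replicate e (1::nat))) = ev p1 (enc (e, tup))"
      by (simp only: p_def ev.simps p2 length_replicate enc_prod_def[of "(e, tup)"] fst_conv snd_conv enc_nat_def)
        (simp only: e_def)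
    also have "\<dots> = enc w"
      unfolding tup_def p1 w_def M_def encode_clocked B_def ..
    finally show ?thesis .
  qed
  have rep: "replicate e (1::nat) \<in> lists {1, 2}" by auto
  have final: "((0, t0 e), (len F, emb m w c)) \<in> (run F)\<^sup>*"
    if "(init D, c) \<in> (step D w)\<^sup>*" "halted D c" for c
  proof (rule exec_run)
    have 1: "exec (calc p m) (t0 e) (st m (reg0 (enc w)) (blank # replicate (n_work D) blank @ [blank]))"
      using exec_calc[OF m rep, of "replicate (n_work D + 1) blank"] unfolding evp
      by (simp add: t0_def replicate_append_same)
    have 2: "exec (EMIT m) (st m (reg0 (enc w)) (blank # replicate (n_work D) blank @ [blank]))
        (st m (reg0 0) ((input_tape w, int (length w)) # replicate (n_work D) blank @ [blank]))"
      using exec_EMIT[OF _ w12, of m "[]"] m by (simp add: input_tape_Nil)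
    show "exec F (t0 e) (emb m w c)" unfolding F_def
      by (rule exec.Seq[OF 1 exec.Seq[OF 2 exec.Seq[OF exec_REWIND[OF w12] exec_RUN[OF D(1) wD that s(1,2)]]]])
  qed
  have "k = m + Suc (n_work D + 1)" by (simp add: k_def)
  then have chain: "t0 0 = replicate k blank"
    by (simp only: t0_def replicate_add) (simp add: input_tape_Nil replicate_append_same)
  have chain_step: "map2 act (t0 i) ch = t0 (Suc i)" for i
  proof -
    have "map2 act (replicate n blank) (replicate n (0, Stay)) = replicate n blank" for n
      by (induction n) auto
    then show ?thesis
      using input_tape_append[of "replicate i 1" 1]
      by (simp add: t0_def ch_def replicate_append_same fun_upd_idem)
  qed
  have runs: "runs_in_time M T \<longleftrightarrow> fst c \<noteq> acc D" if c: "(init D, c) \<in> (step D w)\<^sup>*" "halted D c" for c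
  proof -
    obtain t where "(init D, c) \<in> step D w ^^ t" using c(1) rtrancl_power by blast
    then have "ok_config D c" using ok_nextc_funpow[OF D(1) wD] relpow_step_nextc by metis
    then have "map scan (emb m w c) ! j = fst c" unfolding j_def by (rule scan_emb_state)
    then show ?thesis
      using clocked_runs_in_time[OF chain chain_step final[OF c] e T, where j = j and qa = "acc D" and s = s, folded M_def]
      by simp
  qed
  show False
  proof (cases "w \<in> {encode M | M. wf_tm M \<and> runs_in_time M T}")
    case True
    then obtain M' where "w = encode M'" "wf_tm M'" "runs_in_time M' T" by blast
    moreover have "0 \<le> T n" for n using T[of n] by (rule order_trans[rotated]) simp
    ultimately have "runs_in_time M T"
      using same_runs_in_time[OF tm_code_inj[OF wfM]] wfM by (simp add: w_def)
    moreover obtain i ts where "(init D, (acc D, i, ts)) \<in> (step D w)\<^sup>*"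
      using dec(1)[OF wD True] by (auto simp: accepts_def)
    ultimately show False using runs by (auto simp: halted_def)
  next
    case False
    then have "\<not> runs_in_time M T" using wfM by (auto simp: w_def)
    moreover obtain i ts where "(init D, (rej D, i, ts)) \<in> (step D w)\<^sup>*"
      using dec(2)[OF wD False] by (auto simp: rejects_def)
    moreover have "acc D \<noteq> rej D" using D(1) by (simp add: wf_tm_def)
    ultimately show False using runs by (auto simp: halted_def)
  qed
qed

section \<open>Short running times\<close>

lemma head_bound: "fst (snd ((nextc M w ^^ t) (init M))) \<le> int t"
proof (induction t)
  case 0
  show ?case by (simp add: init_def)
next
  case (Suc t)
  have "fst (snd (nextc M w c)) \<le> fst (snd c) + 1" for c
  proof (cases c)
    case (fields q i ts)
    have "offset m \<le> 1" for m by (cases m) auto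
    then show ?thesis using fields by (auto simp: nextc_def stepf_def split: prod.split)
  qed
  from this[of "(nextc M w ^^ t) (init M)"] show ?case using Suc by simp
qed

text \<open>The head starts on cell \<open>0\<close> and moves by at most one cell, so the first
  \<open>n\<close> steps read no cell from \<open>n\<close> on.\<close>

lemma nextc_prefix:
  assumes "\<And>i. i < int n \<Longrightarrow> input_tape w i = input_tape w' i" "t \<le> n"
  shows "(nextc M w ^^ t) (init M) = (nextc M w' ^^ t) (init M)"
  using assms(2)
proof (induction t)
  case (Suc t)
  obtain q i ts where c: "(nextc M w ^^ t) (init M) = (q, i, ts)" by (metis prod_cases3)
  then have "input_tape w i = input_tape w' i"
    using head_bound[of t M w] Suc.prems assms(1)[of i] by simp
  then have "nextc M w (q, i, ts) = nextc M w' (q, i, ts)" by (simp add: nextc_def stepf_def)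
  with Suc c show ?case by simp
qed simp

lemma halts_within_take:
  assumes "n \<le> length w" "t \<le> n"
  shows "halts_within M w t \<longleftrightarrow> halts_within M (take n w) t"
proof -
  have "input_tape w i = input_tape (take n w) i" if "i < int n" for i
    using that assms(1) by (auto simp: input_tape_def)
  from nextc_prefix[OF this assms(2)] show ?thesis by (simp add: halts_within_def)
qed

definition passes :: "(nat \<times> nat) list \<Rightarrow> tm \<Rightarrow> bool" where
  "passes tests M \<longleftrightarrow> (\<forall>p \<in> set tests. \<forall>w \<in> inputs M. length w = fst p \<longrightarrow> halts_within M w (snd p))"

text \<open>
  A machine that halts within \<open>n0\<close> steps on all inputs of length \<open>n0\<close> sees only the first \<open>n0\<close>
  letters of any longer input.
\<close>

lemma runs_in_time_finite_tests:
  assumes T: "\<And>n. 0 \<le> T n" and n0: "T n0 < real n0 + 1"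
  shows "\<exists>tests. \<forall>M. wf_tm M \<longrightarrow> (runs_in_time M T \<longleftrightarrow> passes tests M)"
proof -
  define t where "t n = nat \<lfloor>T n\<rfloor>" for n
  \<comment> \<open>The strictest bound among all lengths from \<open>n0\<close> on. Its existence
    suffices; it need not be computed from \<open>T\<close>.\<close>
  define m0 where "m0 = (LEAST m. \<exists>n \<ge> n0. m = t n)"
  have "\<exists>m. \<exists>n \<ge> n0. m = t n" by blast
  then have "\<exists>n \<ge> n0. m0 = t n" unfolding m0_def by (rule LeastI_ex)
  then obtain n1 where n1: "n0 \<le> n1" "m0 = t n1" by blast
  have m0_le: "m0 \<le> t n" if "n0 \<le> n" for n unfolding m0_def using that by (intro Least_le) blast
  have "t n0 \<le> n0" using n0 T[of n0] unfolding t_def by linarith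
  then have m0n0: "m0 \<le> n0" using m0_le[of n0] by simp
  define tests where "tests = (n0, m0) # map (\<lambda>n. (n, t n)) [0..<n0]"
  have "runs_in_time M T \<longleftrightarrow> passes tests M" if wf: "wf_tm M" for M
  proof
    assume r: "runs_in_time M T"
    then have h: "halts_within M w (t (length w))" if "w \<in> inputs M" for w
      using that unfolding runs_in_time_iff[OF T] t_def by blast
    have "halts_within M w m0" if w: "w \<in> inputs M" "length w = n0" for w
    proof -
      \<comment> \<open>Padded to the length \<open>n1\<close> at which the bound \<open>m0\<close>
        holds; within \<open>m0 \<le> n0\<close> steps the padding is not seen.\<close>
      define w' where "w' = w @ replicate (n1 - n0) 1"
      have "w' \<in> inputs M" using w(1) wf by (auto simp: w'_def inputs_def wf_tm_def in_lists_conv_set)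
      then have "halts_within M w' m0" using h[of w'] w(2) n1 by (simp add: w'_def)
      moreover have "take n0 w' = w" "n0 \<le> length w'" using w(2) by (simp_all add: w'_def)
      ultimately show ?thesis using halts_within_take[of n0 w' m0 M] m0n0 by simp
    qed
    with h show "passes tests M" by (auto simp: passes_def tests_def)
  next
    assume p: "passes tests M"
    have "halts_within M w (t (length w))" if w: "w \<in> inputs M" for w
    proof (cases "length w < n0")
      case True
      then have "(length w, t (length w)) \<in> set tests" by (auto simp: tests_def)
      with p w show ?thesis unfolding passes_def by fastforce
    next
      case False
      then have len: "n0 \<le> length w" by simp
      have "take n0 w \<in> inputs M" using w by (auto simp: inputs_def in_lists_conv_set dest: in_set_takeD)
      moreover have "(n0, m0) \<in> set tests" by (simp add: tests_def)
      ultimately have "halts_within M (take n0 w) m0" using p len unfolding passes_def by fastforce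
      then have "halts_within M w m0" using halts_within_take[OF len m0n0] by simp
      then show ?thesis using m0_le[OF len] by (rule halts_within_mono)
    qed
    then show "runs_in_time M T" unfolding runs_in_time_iff[OF T] t_def by blast
  qed
  then show ?thesis by blast
qed

section \<open>Simulating machines given by their codes\<close>

text \<open>The default is the blank, so that finite lists represent half tapes that are blank from
  some cell on.\<close>

definition hd0 :: "nat list \<Rightarrow> nat" where
  "hd0 l = (if l = [] then 0 else hd l)"

type_synonym zipper = "nat list \<times> nat list"

text \<open>
  The zipper \<open>(l, r)\<close> is a tape with head symbol \<open>hd0 r\<close>; \<open>l\<close> lists the cells to the left of the
  head from right to left.
\<close>

definition zrep :: "zipper \<Rightarrow> tape \<Rightarrow> bool" where
  "zrep z t \<longleftrightarrow> (\<forall>i. hd0 (drop i (snd z)) = fst t (snd t + int i) \<and>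
     hd0 (drop i (fst z)) = fst t (snd t - 1 - int i))"

definition zmove :: "nat \<Rightarrow> zipper \<Rightarrow> zipper" where
  "zmove m z = (if m = 0 then (tl (fst z), hd0 (fst z) # snd z)
     else if m = 1 then z else (hd0 (snd z) # fst z, tl (snd z)))"

definition zwrite :: "nat \<Rightarrow> zipper \<Rightarrow> zipper" where
  "zwrite b z = (fst z, b # tl (snd z))"

lemma hd0_Cons [simp]: "hd0 (b # l) = b"
  by (simp add: hd0_def)

lemma hd0_drop_tl: "hd0 (drop i (tl l)) = hd0 (drop (Suc i) l)"
  by (simp add: drop_Suc)

lemma hd0_drop_Cons: "hd0 (drop i (b # l)) = (case i of 0 \<Rightarrow> b | Suc j \<Rightarrow> hd0 (drop j l))"
  by (cases i) (auto simp: hd0_def)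

lemma zrep_scan: "zrep z t \<Longrightarrow> hd0 (snd z) = scan t"
  unfolding zrep_def by (cases t) (auto dest: spec[of _ 0])

lemma zrep_move:
  assumes "zrep z (f, h)"
  shows "zrep (zmove m z) (f, h + offset (move_of m))"
proof -
  have r: "hd0 (drop i (snd z)) = f (h + int i)" and l: "hd0 (drop i (fst z)) = f (h - 1 - int i)" for i
    using assms by (auto simp: zrep_def)
  have r0: "hd0 (snd z) = f h" and l0: "hd0 (fst z) = f (h - 1)" using r[of 0] l[of 0] by auto
  consider "m = 0" | "m = 1" | "m \<noteq> 0" "m \<noteq> 1" by blast
  then show ?thesis
  proof cases
    case 1
    have "hd0 (drop i (hd0 (fst z) # snd z)) = f (h - 1 + int i)" for i
      using r by (cases i) (simp_all add: hd0_drop_Cons l0)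
    moreover have "hd0 (drop i (tl (fst z))) = f (h - 1 - 1 - int i)" for i
      unfolding hd0_drop_tl l by (simp add: algebra_simps)
    ultimately show ?thesis using 1 by (simp add: zrep_def zmove_def move_of_def)
  next
    case 2
    then show ?thesis using assms by (simp add: zmove_def move_of_def)
  next
    case 3
    have "hd0 (drop i (hd0 (snd z) # fst z)) = f (h + 1 - 1 - int i)" for i
      using l by (cases i) (simp_all add: hd0_drop_Cons r0 algebra_simps)
    moreover have "hd0 (drop i (tl (snd z))) = f (h + 1 + int i)" for i
      unfolding hd0_drop_tl r by (simp add: algebra_simps)
    ultimately show ?thesis using 3 by (simp add: zrep_def zmove_def move_of_def)
  qed
qed

lemma zrep_write:
  assumes "zrep z (f, h)"
  shows "zrep (zwrite b z) (f(h := b), h)"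
  using assms unfolding zrep_def zwrite_def fst_conv snd_conv
  by (auto simp: hd0_drop_Cons hd0_drop_tl split: nat.split)

type_synonym zconfig = "nat \<times> zipper \<times> zipper list"

definition zact :: "nat \<times> nat \<Rightarrow> zipper \<Rightarrow> zipper" where
  "zact a z = zmove (snd a) (zwrite (fst a) z)"

lemma zrep_act: "zrep z t \<Longrightarrow> zrep (zact (b, m) z) (act t (b, move_of m))"
  by (cases t) (auto simp: zact_def intro: zrep_move zrep_write)

text \<open>\<open>hd (drop j _)\<close> replaces indexing and zipping to stay within the functions
  shown to be computable.\<close>

definition zupdate :: "nat \<Rightarrow> nat \<times> nat \<times> (nat \<times> nat) list \<Rightarrow> zconfig \<Rightarrow> zconfig" where
  "zupdate k d c = (fst d, zmove (fst (snd d)) (fst (snd c)),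
     map (\<lambda>j. zact (hd (drop j (snd (snd d)))) (hd (drop j (snd (snd c))))) [0..<k])"

definition zstep :: "nat list \<Rightarrow> zconfig \<Rightarrow> zconfig" where
  "zstep L c = (if fst c = entry L 5 \<or> fst c = entry L 6 then c
     else zupdate (entry L 3) (deltaL L (fst c, hd0 (snd (fst (snd c))), map (\<lambda>z. hd0 (snd z)) (snd (snd c)))) c)"

definition zhalts :: "nat list \<Rightarrow> nat list \<Rightarrow> nat \<Rightarrow> bool" where
  "zhalts L w t \<longleftrightarrow> fst ((zstep L ^^ t) (entry L 4, ([], w), replicate (entry L 3) ([], []))) \<in> {entry L 5, entry L 6}"

definition zrep_config :: "nat list \<Rightarrow> nat list \<Rightarrow> zconfig \<Rightarrow> config \<Rightarrow> bool" where
  "zrep_config L w = (\<lambda>(p, z, zs) (q, i, ts). p = q \<and> zrep z (input_tape w, i) \<and>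
     length zs = entry L 3 \<and> list_all2 zrep zs ts)"

lemma zrep_step:
  assumes "zrep_config L w c c'"
  shows "zrep_config L w (zstep L c) (nextc (tmL L) w c')"
proof (cases c; cases c')
  fix p z zs q i ts assume c: "c = (p, z, zs)" and c': "c' = (q, i, ts)"
  have pq: "p = q" and z: "zrep z (input_tape w, i)" and len: "length zs = entry L 3" and zs: "list_all2 zrep zs ts"
    using assms by (auto simp: c c' zrep_config_def)
  have scan: "hd0 (snd z) = input_tape w i" using zrep_scan[OF z] by simp
  have lts: "length ts = entry L 3" using zs len by (simp add: list_all2_lengthD[symmetric])
  have nth: "zrep (zs ! j) (ts ! j)" if "j < entry L 3" for j
    using list_all2_nthD[OF zs] that len by simp
  have scans: "map (\<lambda>z. hd0 (snd z)) zs = map scan ts"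
    using len lts nth by (intro nth_equalityI) (simp_all only: length_map nth_map zrep_scan)
  show ?thesis
  proof (cases "q = entry L 5 \<or> q = entry L 6")
    case True
    then show ?thesis using assms pq by (auto simp: c c' zstep_def nextc_def halted_def tmL_def)
  next
    case False
    obtain q' m acts where d: "deltaL L (q, input_tape w i, map scan ts) = (q', m, acts)" by (metis prod_cases3)
    have la: "length acts = entry L 3" using d by (auto simp: deltaL_def)
    have nx: "nextc (tmL L) w c' = (q', i + offset (move_of m), map2 act ts (map (\<lambda>(b, m). (b, move_of m)) acts))"
      using False by (simp add: c' nextc_def halted_def tmL_def stepf_def d)
    have zx: "zstep L c = (q', zmove m z, map (\<lambda>j. zact (hd (drop j acts)) (hd (drop j zs))) [0..<entry L 3])"
      using False pq by (simp add: c zstep_def scan scans d zupdate_def)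
    have "list_all2 zrep (map (\<lambda>j. zact (hd (drop j acts)) (hd (drop j zs))) [0..<entry L 3])
        (map2 act ts (map (\<lambda>(b, m). (b, move_of m)) acts))"
    proof (rule list_all2_all_nthI)
      fix j assume "j < length (map (\<lambda>j. zact (hd (drop j acts)) (hd (drop j zs))) [0..<entry L 3])"
      then have j: "j < entry L 3" by simp
      obtain b m where a: "acts ! j = (b, m)" by fastforce
      show "zrep (map (\<lambda>j. zact (hd (drop j acts)) (hd (drop j zs))) [0..<entry L 3] ! j)
          (map2 act ts (map (\<lambda>(b, m). (b, move_of m)) acts) ! j)"
        using zrep_act[OF nth[OF j], of b m] j la len lts a by (simp add: hd_drop_conv_nth)
    qed (use la lts in simp)
    then show ?thesis unfolding zx nx using zrep_move[OF z] by (simp add: zrep_config_def)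
  qed
qed

lemma zhalts_iff: "zhalts L w t \<longleftrightarrow> halts_within (tmL L) w t"
proof -
  let ?z = "(entry L 4, ([], w), replicate (entry L 3) ([], []))"
  have "hd0 (drop i w) = input_tape w (int i)" for i
    by (auto simp: hd0_def input_tape_def hd_drop_conv_nth)
  then have "zrep ([], w) (input_tape w, 0)" by (simp add: zrep_def) (simp add: hd0_def input_tape_def)
  moreover have "zrep ([], []) blank" by (simp add: zrep_def hd0_def)
  ultimately have "zrep_config L w ?z (init (tmL L))"
    by (simp add: zrep_config_def init_def tmL_def list_all2_conv_all_nth)
  then have "zrep_config L w ((zstep L ^^ t) ?z) ((nextc (tmL L) w ^^ t) (init (tmL L)))"
    by (induction t) (simp_all add: zrep_step)
  then have "fst ((zstep L ^^ t) ?z) = fst ((nextc (tmL L) w ^^ t) (init (tmL L)))"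
    by (auto simp: zrep_config_def split: prod.splits)
  then show ?thesis by (simp add: zhalts_def halts_within_def halted_def tmL_def)
qed

definition codeL :: "nat list \<Rightarrow> nat list" where
  "codeL L = [entry L 0, entry L 1, entry L 2, entry L 3, entry L 4, entry L 5, entry L 6] @
     concat (map (\<lambda>x. fst (deltaL L x) # fst (snd (deltaL L x)) #
       concat (map (\<lambda>a. [fst a, snd a]) (snd (snd (deltaL L x))))) (argsL L))"

lemma args_tmL: "args_tm (tmL L) = argsL L"
  by (simp add: args_tm_def argsL_def tmL_def)

lemma tm_code_tmL: "tm_code (tmL L) = codeL L"
proof -
  have "row_code (delta (tmL L) q a bs) = fst (deltaL L (q, a, bs)) # fst (snd (deltaL L (q, a, bs))) #
      concat (map (\<lambda>a. [fst a, snd a]) (snd (snd (deltaL L (q, a, bs)))))" for q a bs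
    by (auto simp: tmL_def deltaL_def comp_def intro!: arg_cong[of _ _ concat])
  then show ?thesis
    unfolding tm_code_args args_tmL codeL_def
    by (auto simp: header_def tmL_def split_def)
qed

definition wfL :: "nat list \<Rightarrow> bool" where
  "wfL L \<longleftrightarrow> 1 \<le> entry L 1 \<and> entry L 1 < entry L 2 \<and> entry L 4 < entry L 0 \<and> entry L 5 < entry L 0 \<and>
     entry L 6 < entry L 0 \<and> entry L 5 \<noteq> entry L 6 \<and>
     list_all (\<lambda>x. fst (deltaL L x) < entry L 0 \<and>
       list_all (\<lambda>a. fst a < entry L 2) (snd (snd (deltaL L x)))) (argsL L)"

lemma wf_tmL: "wf_tm (tmL L) \<longleftrightarrow> wfL L"
proof -
  have "(case delta (tmL L) q a bs of (q', m, acts) \<Rightarrow>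
       q' < n_states (tmL L) \<and> length acts = n_work (tmL L) \<and> fst ` set acts \<subseteq> {0..<n_symbols (tmL L)}) \<longleftrightarrow>
     fst (deltaL L (q, a, bs)) < entry L 0 \<and> list_all (\<lambda>a. fst a < entry L 2) (snd (snd (deltaL L (q, a, bs))))" for q a bs
    by (auto simp: tmL_def deltaL_def list_all_iff image_subset_iff)
  then have "wf_tm (tmL L) \<longleftrightarrow> 1 \<le> entry L 1 \<and> entry L 1 < entry L 2 \<and> entry L 4 < entry L 0 \<and> entry L 5 < entry L 0 \<and>
     entry L 6 < entry L 0 \<and> entry L 5 \<noteq> entry L 6 \<and>
     (\<forall>q a bs. (q, a, bs) \<in> set (argsL L) \<longrightarrow> fst (deltaL L (q, a, bs)) < entry L 0 \<and>
       list_all (\<lambda>a. fst a < entry L 2) (snd (snd (deltaL L (q, a, bs)))))"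
    unfolding wf_tm_iff set_args_tm[symmetric] args_tmL by (simp add: tmL_def)
  then show ?thesis by (simp add: wfL_def list_all_iff Ball_def split_paired_All)
qed

definition passesL :: "(nat \<times> nat) list \<Rightarrow> nat list \<Rightarrow> bool" where
  "passesL tests L \<longleftrightarrow> list_all (\<lambda>p. list_all (\<lambda>w. zhalts L w (snd p))
     (List.n_lists (fst p) [1..<Suc (entry L 1)])) tests"

lemma passes_tmL: "passes tests (tmL L) \<longleftrightarrow> passesL tests L"
proof -
  have "w \<in> inputs (tmL L) \<and> length w = n \<longleftrightarrow> w \<in> set (List.n_lists n [1..<Suc (entry L 1)])" for w n
    by (auto simp: inputs_def tmL_def set_n_lists in_lists_conv_set less_Suc_eq_le subset_iff simp del: upt_Suc)
  then show ?thesis unfolding passes_def passesL_def list_all_iff zhalts_iff by blast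
qed

definition check :: "(nat \<times> nat) list \<Rightarrow> nat list \<Rightarrow> bool" where
  "check tests w \<longleftrightarrow> encL (parse w) = w \<and> codeL (parse w) = parse w \<and> wfL (parse w) \<and> passesL tests (parse w)"

text \<open>The first two conditions of \<open>check\<close> say that \<open>w\<close> is the code
  of \<open>tmL (parse w)\<close>, which is then itself a witness. Conversely, a machine with code
  \<open>w\<close> is \<open>same\<close> as this one, hence passes the same tests.\<close>

lemma check_iff: "check tests w \<longleftrightarrow> w \<in> {encode M | M. wf_tm M \<and> passes tests M}"
proof
  assume "check tests w"
  then have "w = encode (tmL (parse w))" "wf_tm (tmL (parse w))" "passes tests (tmL (parse w))"
    by (auto simp: check_def encode_encL tm_code_tmL wf_tmL passes_tmL)
  then show "w \<in> {encode M | M. wf_tm M \<and> passes tests M}" by blast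
next
  assume "w \<in> {encode M | M. wf_tm M \<and> passes tests M}"
  then obtain M where w: "w = encode M" and M: "wf_tm M" "passes tests M" by blast
  note same = same_tmL[OF M(1)]
  have "inputs (tmL (tm_code M)) = inputs M" using same by (simp add: inputs_def same_def)
  then have "passes tests (tmL (tm_code M))"
    using M(2) same_halts_within[OF same M(1)] by (simp add: passes_def)
  then show "check tests w"
    using same_tm_code[OF same] same_wf[OF same M(1)]
    by (simp add: check_def w encode_encL tm_code_tmL wf_tmL passes_tmL)
qed

section \<open>Computability of the simulation and of the check\<close>

lemma computable_entry [computable_intros]:
  assumes "computable f" "computable g" shows "computable (\<lambda>x. entry (f x) (g x))"
  unfolding entry_def by (intro computable_intros assms)

lemma computable_argsL [computable_intros]:
  assumes "computable f" shows "computable (\<lambda>x. argsL (f x))"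
  unfolding argsL_def args_def by (intro computable_intros assms computable_compose[OF assms])

lemma computable_min [computable_intros]:
  fixes f g :: "_ \<Rightarrow> nat"
  assumes "computable f" "computable g" shows "computable (\<lambda>x. min (f x) (g x))"
  unfolding min_def by (intro computable_intros assms)

lemma computable_rowL [computable_intros]:
  assumes "computable f" "computable g" "computable h" shows "computable (\<lambda>x. rowL (f x) (g x) (h x))"
  unfolding rowL_def
  by (intro computable_intros assms computable_compose[OF assms(1)] computable_compose[OF assms(2)])

lemma computable_deltaL [computable_intros]:
  assumes "computable f" "computable g" shows "computable (\<lambda>x. deltaL (f x) (g x))"
  unfolding deltaL_def
  by (intro computable_intros assms computable_compose[OF assms(1)] computable_compose[OF assms(2)])

lemma computable_hd0 [computable_intros]:
  assumes "computable f" shows "computable (\<lambda>x. hd0 (f x))"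
  unfolding hd0_def by (intro computable_intros assms)

lemma computable_zact [computable_intros]:
  assumes "computable f" "computable g" shows "computable (\<lambda>x. zact (f x) (g x))"
  unfolding zact_def zmove_def zwrite_def by (intro computable_intros assms)

lemma computable_zmove [computable_intros]:
  assumes "computable f" "computable g" shows "computable (\<lambda>x. zmove (f x) (g x))"
  unfolding zmove_def by (intro computable_intros assms)

lemma computable_zupdate [computable_intros]:
  assumes "computable f" "computable g" "computable h" shows "computable (\<lambda>x. zupdate (f x) (g x) (h x))"
  unfolding zupdate_def
  by (intro computable_intros assms computable_compose[OF assms(2)] computable_compose[OF assms(3)])

lemma computable_zstep [computable_intros]:
  assumes "computable f" "computable g" shows "computable (\<lambda>x. zstep (f x) (g x))"
  unfolding zstep_def by (intro computable_intros assms)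

lemma computable_zhalts [computable_intros]:
  assumes "computable f" "computable g" "computable h" shows "computable (\<lambda>x. zhalts (f x) (g x) (h x))"
  unfolding zhalts_def insert_iff empty_iff simp_thms
  by (intro computable_intros assms computable_compose[OF assms(1)])

text \<open>\<open>tests\<close> is a fixed list and enters as a constant, wherever its entries come
  from.\<close>

lemma computable_check: "computable (check tests)"
  unfolding check_def[abs_def] parse_def codeL_def wfL_def passesL_def by (intro computable_intros)

section \<open>A decider from a computable function\<close>

text \<open>State \<open>len F + 3\<close> copies the input to tape \<open>m\<close> and enters the
  program at the first blank. At the exit \<open>len F\<close>, reading \<open>1\<close> on counter
  \<open>0\<close> means that its value is \<open>0\<close>, the code of \<open>False\<close>, so
  the machine rejects.\<close>

definition decider_delta :: "com \<Rightarrow> nat \<Rightarrow> nat \<Rightarrow> nat \<Rightarrow> nat list \<Rightarrow> nat \<times> move \<times> (nat \<times> move) list" where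
  "decider_delta F m q a bs =
     (if q < len F then (case nxt F q bs of (q', acts) \<Rightarrow> (q', Stay, acts))
      else if q = len F then (if bs ! 0 = 1 then len F + 2 else len F + 1, Stay, stay bs)
      else if a = 0 then (0, Stay, stay bs)
      else (len F + 3, MoveRight, (stay bs)[m := (a, MoveRight)]))"

definition decider :: "com \<Rightarrow> nat \<Rightarrow> tm" where
  "decider F m = \<lparr>n_states = len F + 4, n_inputs = 2, n_symbols = 3, n_work = Suc m,
     start = len F + 3, acc = len F + 1, rej = len F + 2, delta = decider_delta F m\<rparr>"

lemma wf_decider:
  assumes "wf_com (Suc m) 3 F"
  shows "wf_tm (decider F m)"
proof -
  have "case decider_delta F m q a bs of (q', mv, acts) \<Rightarrow>
      q' < len F + 4 \<and> length acts = Suc m \<and> fst ` set acts \<subseteq> {0..<3}"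
    if "dom_tm (decider F m) q a bs" for q a bs
  proof -
    have bs: "length bs = Suc m" "set bs \<subseteq> {0..<3}" and a: "a < 3"
      using that by (auto simp: dom_tm_def decider_def)
    obtain q' acts where n: "nxt F q bs = (q', acts)" by fastforce
    have "fst ` set (stay bs) \<subseteq> {0..<3}" using bs by simp
    moreover have "fst ` set ((stay bs)[m := (a, MoveRight)]) \<subseteq> {0..<3}"
    proof -
      have "fst ` set ((stay bs)[m := (a, MoveRight)]) \<subseteq> fst ` insert (a, MoveRight) (set (stay bs))"
        by (intro image_mono set_update_subset_insert)
      then show ?thesis using bs a by auto
    qed
    moreover have "q' < len F + 4 \<and> length acts = Suc m \<and> fst ` set acts \<subseteq> {0..<3}" if "q < len F"
      using wf_com_nxt[OF assms that bs n] by simp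
    ultimately show ?thesis using bs(1) a n
      by (auto simp: decider_delta_def simp del: fst_stay)
  qed
  then show ?thesis unfolding wf_tm_iff by (simp add: decider_def)
qed

lemma decidable_if_computable:
  assumes "computable P"
  shows "decidable {w. P w}"
proof -
  obtain p where p: "\<And>w. ev p (enc w) = enc (P w)" using assms unfolding computable_def by blast
  define m where "m = regs p + 1"
  have m: "4 \<le> m" "regs p \<le> m" using regs_ge[of p] by (simp_all add: m_def)
  define F where "F = calc p m"
  define D where "D = decider F m"
  have wf: "wf_tm D" unfolding D_def F_def using m by (intro wf_decider wf_com_calc) simp_all
  have D: "n_inputs D = 2" "acc D = len F + 1" "rej D = len F + 2" by (simp_all add: D_def decider_def)
  have nextc: "(c, nextc D w c) \<in> step D w" if "\<not> halted D c" for c w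
    using that by (simp add: step_iff)
  have result: "\<exists>i ts. (init D, (if P w then acc D else rej D, i, ts)) \<in> (step D w)\<^sup>*" if w: "w \<in> inputs D" for w
  proof -
    have w12: "w \<in> lists {1, 2}" using w by (auto simp: inputs_def D in_lists_conv_set)
    define n where "n = length w"
    define t where "t i = replicate m blank @ [(input_tape (take i w), int i)]" for i
    have copy: "(init D, (len F + 3, int i, t i)) \<in> (step D w)\<^sup>*" if "i \<le> n" for i
      using that
    proof (induction i)
      case 0
      have "init D = (len F + 3, int 0, t 0)"
        by (simp add: init_def D_def decider_def t_def input_tape_Nil flip: replicate_append_same)
      then show ?case by simp
    next
      case (Suc i)
      have "w ! i \<in> {1, 2}" using w12 Suc.prems by (auto simp: in_lists_conv_set n_def simp del: insert_iff)
      then have wi: "w ! i \<noteq> 0" by auto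
      have sym: "input_tape w (int i) = w ! i" using Suc.prems by (simp add: input_tape_def n_def)
      have "stay (map scan (t i)) = stay (map scan (replicate m blank)) @ [(0, Stay)]"
        by (simp add: t_def stay_def input_tape_def)
      then have "(stay (map scan (t i)))[m := (w ! i, MoveRight)] =
          stay (map scan (replicate m blank)) @ [(w ! i, MoveRight)]" by (simp add: list_update_append)
      moreover have "map2 act (t i) (stay (map scan (replicate m blank)) @ [(w ! i, MoveRight)]) = t (Suc i)"
        using Suc.prems input_tape_append[of "take i w" "w ! i"] unfolding t_def
        by (subst zip_append) (simp_all add: n_def take_Suc_conv_app_nth del: map_replicate)
      ultimately have "nextc D w (len F + 3, int i, t i) = (len F + 3, int (Suc i), t (Suc i))"
        using wi by (simp add: nextc_def halted_def D stepf_def D_def decider_def decider_delta_def sym)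
      then show ?case using Suc nextc[of "(len F + 3, int i, t i)" w]
        by (simp add: halted_def D rtrancl_into_rtrancl)
    qed
    have "input_tape w (int n) = 0" by (simp add: input_tape_def n_def)
    then have "nextc D w (len F + 3, int n, t n) = (0, int n, t n)"
      by (simp add: nextc_def halted_def stepf_def D_def decider_def decider_delta_def)
    then have 1: "(init D, (0, int n, t n)) \<in> (step D w)\<^sup>*"
      using copy[of n] nextc[of "(len F + 3, int n, t n)" w] by (simp add: halted_def D rtrancl_into_rtrancl)
    define r where "r = st m (reg0 (enc (P w))) [blank]"
    have "exec F (t n) r"
      using exec_calc[OF m w12, of "[]"] by (simp add: F_def t_def r_def n_def p)
    then have "((0, t n), (len F, r)) \<in> (run F)\<^sup>*" by (rule exec_run)
    then have "((\<lambda>(p, ts). (p, int n, ts)) (0, t n), (\<lambda>(p, ts). (p, int n, ts)) (len F, r)) \<in> (step D w)\<^sup>*"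
    proof (rule rtrancl_lift)
      fix x y assume xy: "(x, y) \<in> run F"
      obtain q ts q' ts' where [simp]: "x = (q, ts)" "y = (q', ts')" by fastforce
      have q: "q < len F" using xy by (simp add: run_iff)
      then have "nextc D w (q, int n, ts) = (q', int n, ts')"
        using xy by (auto simp: run_iff nextc_def halted_def stepf_def D_def decider_def decider_delta_def split: prod.split)
      moreover have "\<not> halted D (q, int n, ts)" using q by (simp add: halted_def D)
      ultimately show "((\<lambda>(p, ts). (p, int n, ts)) x, (\<lambda>(p, ts). (p, int n, ts)) y) \<in> (step D w)\<^sup>*"
        using nextc[of "(q, int n, ts)" w] by simp
    qed
    then have 2: "((0, int n, t n), (len F, int n, r)) \<in> (step D w)\<^sup>*" by simp
    have "map scan r ! 0 = scan (ctr (enc (P w)))" using m unfolding r_def by (simp add: nth_st)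
    then have r0: "map scan r ! 0 = (if P w then 0 else 1)" by (simp add: scan_ctr enc_bool_def)
    have "nextc D w (len F, int n, r) = (if P w then acc D else rej D, int n, r)"
      using r0 by (simp add: nextc_def halted_def stepf_def D_def decider_def decider_delta_def)
    moreover have "\<not> halted D (len F, int n, r)" by (simp add: halted_def D)
    ultimately have "((len F, int n, r), (if P w then acc D else rej D, int n, r)) \<in> step D w"
      using nextc by metis
    with 1 2 show ?thesis by (meson rtrancl_into_rtrancl rtrancl_trans)
  qed
  have "accepts D w" if "w \<in> inputs D" "P w" for w
    using result[OF that(1)] that(2) by (simp add: accepts_def)
  moreover have "rejects D w" if "w \<in> inputs D" "\<not> P w" for w
    using result[OF that(1)] that(2) by (simp add: rejects_def)
  ultimately show ?thesis unfolding decidable_def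
    using wf D(1) by (intro exI[of _ D]) simp
qed

theorem theorem3p3:
  fixes T :: "nat \<Rightarrow> real"
  assumes "\<And>n. T n \<ge> 0"
  shows "\<not> decidable {encode M | M. wf_tm M \<and> runs_in_time M T} \<longleftrightarrow> (\<forall>n. T n \<ge> real n + 1)"
proof
  assume undec: "\<not> decidable {encode M | M. wf_tm M \<and> runs_in_time M T}"
  show "\<forall>n. T n \<ge> real n + 1"
  proof (rule ccontr)
    assume "\<not> ?thesis"
    then obtain n0 where "T n0 < real n0 + 1" by (auto simp: not_le)
    then obtain tests where "\<And>M. wf_tm M \<Longrightarrow> runs_in_time M T \<longleftrightarrow> passes tests M"
      using runs_in_time_finite_tests[of T, OF assms] by blast
    then have "{encode M | M. wf_tm M \<and> runs_in_time M T} = {w. check tests w}"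
      unfolding check_iff by blast
    with undec decidable_if_computable[OF computable_check[of tests]] show False by simp
  qed
next
  assume "\<forall>n. T n \<ge> real n + 1"
  then show "\<not> decidable {encode M | M. wf_tm M \<and> runs_in_time M T}"
    by (intro undecidable_if_ge_Suc) simp
qed

end
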